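(* Let $\nu$ be a compactly supported Borel probability measure on $\mathbb{R}^d$ with $\overline{\dim}_{M}(\nu)>0$. Then the following statements are equivalent: (1) $\overline{D}_{r}(\nu)=\overline{\dim}_{M}(\nu)$ for some $r>0$. (2) $\overline{\mathfrak{R}}_{\nu}(q)=\overline{\dim}_{M}(\nu)$ for some $q\in(0,1)$. (3) $\partial^{-}\beta_{\nu}(1)\leq-\overline{\dim}_{M}(\nu)$. (4) The $L^{q}$-spectrum is linear on $[0,1]$, i.e. $\beta_{\nu}(q)=\overline{\dim}_{M}(\nu)(1-q)$ for all $q\in[0,1]$. (5) $\overline{D}_{r}(\nu)=\overline{\dim}_{M}(\nu)$ for all $r>0$. In particular, each of the conditions $\dim_{P}^{*}(\nu)=\overline{\dim}_{M}(\nu)$ and $\dim_{H}(\nu)=\overline{\dim}_{M}(\nu)$ implies (3), and hence all of the statements (1), (2), (3), (4) and (5).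
   Context: For $n\in\mathbb{N}$ let $\mathcal{D}_n$ be the partition of $\mathbb{R}^d$ into half-open cubes $\prod_{i=1}^d(k_i2^{-n},(k_i+1)2^{-n}]$, $k\in\mathbb{Z}^d$. For $r>0$ let $\mathfrak{e}_{n,r}(\nu)=\inf\left\{\left(\int d(x,\alpha)^r\,d\nu(x)\right)^{1/r}:\alpha\subset\mathbb{R}^d,\ 1\le\mathrm{card}(\alpha)\le n\right\}$ with $d(x,\alpha)=\min_{y\in\alpha}\|x-y\|$. The upper quantization dimension of order $r$ is $\overline{D}_r(\nu)=\limsup_{n\to\infty}\frac{\log n}{-\log\mathfrak{e}_{n,r}(\nu)}$ (the quotient is $0$ if $\mathfrak{e}_{n,r}(\nu)=0$). The $L^q$-spectrum is, for $q\ge0$, $\beta_\nu(q)=\limsup_{n\to\infty}\frac{\log\left(\sum_{C\in\mathcal{D}_n}\nu(C)^q\right)}{\log(2^n)}$ (with $0^0=0$), $\partial^-\beta_\nu(1)$ is its left-sided derivative at $1$, and the Rényi dimension for $q\in(0,1)$ is $\overline{\mathfrak{R}}_\nu(q)=\beta_\nu(q)/(1-q)$. $\overline{\dim}_M(\nu)$ is the upper Minkowski (box-counting) dimension of $\mathrm{supp}(\nu)$. With $\dim_H$ and $\dim_P$ on sets denoting Hausdorff and packing dimension, $\dim_P^*(\nu)=\inf\{\dim_P(A):A\subset\mathbb{R}^d\text{ Borel},\ \nu(A)=\nu(\mathbb{R}^d)\}$ and $\dim_H(\nu)=\inf\{\dim_H(A):A\subset\mathbb{R}^d\text{ Borel},\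 \nu(A)>0\}$. *)

theory Defs
  imports "HOL-Probability.Probability"
begin

text \<open>
  \<open>\<real>\<^sup>d\<close> is rendered as \<open>real ^ 'd\<close> with the Euclidean norm. Dimensions and \<open>L\<^sup>q\<close>-spectra
  are \<open>limsup\<close>s and infima, and take values in \<open>ereal\<close>.
\<close>

definition measure_support :: "(real ^ 'd) measure \<Rightarrow> (real ^ 'd) set" where
  "measure_support \<nu> = {x. \<forall>U. open U \<and> x \<in> U \<longrightarrow> emeasure \<nu> U > 0}"

definition dyadic_cube :: "nat \<Rightarrow> int ^ 'd \<Rightarrow> (real ^ 'd) set" where
  "dyadic_cube n k =
     {x. \<forall>i. of_int (k $ i) / 2 ^ n < x $ i \<and> x $ i \<le> (of_int (k $ i) + 1) / 2 ^ n}"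

definition dyadic_cubes :: "nat \<Rightarrow> (real ^ 'd) set set" where
  "dyadic_cubes n = range (dyadic_cube n)"


subsection \<open>Quantization\<close>

text \<open>
  For a compactly supported probability measure the integrand below is integrable, so the
  Bochner integral is the true one. The index \<open>n = 0\<close> (no admissible \<open>\<alpha>\<close>) does not influence
  the \<open>limsup\<close>.
\<close>

definition quantization_error :: "nat \<Rightarrow> real \<Rightarrow> (real ^ 'd) measure \<Rightarrow> real" where
  "quantization_error n r \<nu> =
     (INF \<alpha> \<in> {\<alpha>. finite \<alpha> \<and> 1 \<le> card \<alpha> \<and> card \<alpha> \<le> n}.
        (\<integral>x. infdist x \<alpha> powr r \<partial>\<nu>) powr (1 / r))"

definition upper_quantization_dim :: "real \<Rightarrow> (real ^ 'd) measure \<Rightarrow> ereal" where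
  "upper_quantization_dim r \<nu> =
     limsup (\<lambda>n. ereal (if quantization_error n r \<nu> = 0 then 0
                        else ln (real n) / (- ln (quantization_error n r \<nu>))))"


subsection \<open>\<open>L\<^sup>q\<close>-spectrum and Renyi dimension\<close>

text \<open>
  The convention \<open>0\<^sup>0 = 0\<close> is the library's \<open>0 powr 0 = 0\<close>. For a compactly supported measure
  only finitely many summands are non-zero. For a compactly supported probability measure
  the spectrum is finite and convex on \<open>[0, \<infinity>)\<close>, so its left-sided derivative at \<open>1\<close> exists and
  can be taken of \<open>\<lambda>q. real_of_ereal (lq_spectrum \<nu> q)\<close> without loss.
\<close>

definition lq_spectrum :: "(real ^ 'd) measure \<Rightarrow> real \<Rightarrow> ereal" where
  "lq_spectrum \<nu> q =
     limsup (\<lambda>n. ereal (ln (\<Sum>\<^sub>\<infinity>C\<in>dyadic_cubes n. measure \<nu> C powr q) / ln (2 ^ n)))"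

definition upper_renyi_dim :: "(real ^ 'd) measure \<Rightarrow> real \<Rightarrow> ereal" where
  "upper_renyi_dim \<nu> q = lq_spectrum \<nu> q / ereal (1 - q)"


subsection \<open>Upper Minkowski dimension\<close>

definition covering_number :: "real \<Rightarrow> (real ^ 'd) set \<Rightarrow> nat" where
  "covering_number \<delta> A =
     (LEAST N. \<exists>\<U>. finite \<U> \<and> card \<U> = N \<and> A \<subseteq> \<Union>\<U> \<and> (\<forall>U\<in>\<U>. bounded U \<and> diameter U \<le> \<delta>))"

definition upper_box_dim :: "(real ^ 'd) set \<Rightarrow> ereal" where
  "upper_box_dim A =
     Limsup (at_right 0) (\<lambda>\<delta>. ereal (ln (real (covering_number \<delta> A)) / (- ln \<delta>)))"

definition upper_minkowski_dim :: "(real ^ 'd) measure \<Rightarrow> ereal" where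
  "upper_minkowski_dim \<nu> = upper_box_dim (measure_support \<nu>)"


subsection \<open>Hausdorff dimension\<close>

text \<open>
  Both the Hausdorff and the packing dimension are written as the infimum over \<open>s > 0\<close> of the
  exponents with vanishing \<open>s\<close>-dimensional measure. Omitting \<open>s = 0\<close> does not change the
  infimum and avoids \<open>0\<^sup>0\<close>, which in the counting measure would have to be \<open>1\<close>.
\<close>

definition hausdorff_premeasure :: "real \<Rightarrow> real \<Rightarrow> (real ^ 'd) set \<Rightarrow> ennreal" where
  "hausdorff_premeasure s \<delta> A =
     (INF U \<in> {U :: nat \<Rightarrow> (real ^ 'd) set.
                 A \<subseteq> (\<Union>i. U i) \<and> (\<forall>i. bounded (U i) \<and> diameter (U i) \<le> \<delta>)}.
        \<Sum>i. ennreal (diameter (U i) powr s))"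

definition hausdorff_measure :: "real \<Rightarrow> (real ^ 'd) set \<Rightarrow> ennreal" where
  "hausdorff_measure s A = (SUP \<delta>\<in>{0<..}. hausdorff_premeasure s \<delta> A)"

definition hausdorff_dim :: "(real ^ 'd) set \<Rightarrow> ereal" where
  "hausdorff_dim A = (INF s \<in> {s. 0 < s \<and> hausdorff_measure s A = 0}. ereal s)"


subsection \<open>Packing dimension\<close>

text \<open>
  A \<open>\<delta>\<close>-packing of \<open>A\<close> is a countable family of pairwise disjoint closed balls with centres in
  \<open>A\<close> and radii at most \<open>\<delta>\<close>, given by its set of pairs (centre, radius). The packing measure is
  the countably subadditive regularization of the packing premeasure.
\<close>

definition ball_packings :: "real \<Rightarrow> (real ^ 'd) set \<Rightarrow> ((real ^ 'd) \<times> real) set set" where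
  "ball_packings \<delta> A =
     {P. countable P \<and> (\<forall>(x, \<rho>)\<in>P. x \<in> A \<and> 0 < \<rho> \<and> \<rho> \<le> \<delta>) \<and>
         disjoint_family_on (\<lambda>(x, \<rho>). cball x \<rho>) P}"

definition packing_premeasure :: "real \<Rightarrow> (real ^ 'd) set \<Rightarrow> ennreal" where
  "packing_premeasure s A =
     (INF \<delta>\<in>{0<..}. SUP P\<in>ball_packings \<delta> A.
        \<integral>\<^sup>+ p. ennreal ((2 * snd p) powr s) \<partial>count_space P)"

definition packing_measure :: "real \<Rightarrow> (real ^ 'd) set \<Rightarrow> ennreal" where
  "packing_measure s A =
     (INF F \<in> {F :: nat \<Rightarrow> (real ^ 'd) set. A \<subseteq> (\<Union>i. F i)}. \<Sum>i. packing_premeasure s (F i))"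

definition packing_dim :: "(real ^ 'd) set \<Rightarrow> ereal" where
  "packing_dim A = (INF s \<in> {s. 0 < s \<and> packing_measure s A = 0}. ereal s)"


subsection \<open>Dimensions of measures\<close>

definition upper_packing_dim_measure :: "(real ^ 'd) measure \<Rightarrow> ereal" where
  "upper_packing_dim_measure \<nu> =
     (INF A \<in> {A. A \<in> sets borel \<and> emeasure \<nu> A = emeasure \<nu> UNIV}. packing_dim A)"

definition lower_hausdorff_dim_measure :: "(real ^ 'd) measure \<Rightarrow> ereal" where
  "lower_hausdorff_dim_measure \<nu> =
     (INF A \<in> {A. A \<in> sets borel \<and> emeasure \<nu> A > 0}. hausdorff_dim A)"

end

theory Submission
  imports Defs "HOL-Real_Asymp.Real_Asymp"
begin

text \<open>
  Write \<open>D\<close> for the upper Minkowski dimension. The spectrum \<open>\<beta>\<close> is convex on \<open>[0, 1]\<close> with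
  \<open>\<beta> 0 = D\<close> and \<open>\<beta> 1 = 0\<close>, so it is either equal to \<open>D (1 - q)\<close> or strictly below it throughout
  \<open>(0, 1)\<close>. If it is equal, then at infinitely many scales \<open>2\<^sup>-\<^sup>n\<close> about \<open>2\<^sup>n\<^sup>D\<close> cubes have mass about
  \<open>2\<^sup>-\<^sup>n\<^sup>D\<close>; a codebook with far fewer points misses most of them, which forces quantization
  dimension \<open>D\<close> for every \<open>r\<close>. If it is strictly below, then an adaptive dyadic codebook gives
  quantization dimension at most \<open>r q / (1 - q)\<close> whenever \<open>\<beta> q < r q\<close>, and some such \<open>q\<close> makes
  this bound smaller than \<open>D\<close>. Moreover \<open>\<beta> q < a (1 - q)\<close> with \<open>a < D\<close> implies, by
  Borel-Cantelli, that almost every point lies in cubes of mass at least \<open>2\<^sup>-\<^sup>n\<^sup>a\<close> at all small scales;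
  there are at most \<open>2\<^sup>n\<^sup>a\<close> of these, so the packing and Hausdorff dimensions of \<open>\<nu>\<close> are at most \<open>a\<close>.
\<close>

subsection \<open>Dyadic cubes\<close>

text \<open>Nearby points need not share a dyadic cube, so every comparison of distances with cubes
  passes through the block of adjacent cubes. Its cardinality is a dimensional constant that no
  exponent sees. Since \<open>beta\<close> is a limsup, upper bounds on the moment sums hold at all
  large scales, lower bounds only at infinitely many. This suffices because the quantization
  dimension is an upper limit too: one frequent estimate is combined with otherwise eventual ones.
  The exponent \<open>r q / (1 - q)\<close> has this origin: if \<open>beta q < r q\<close>,
  counting the cubes of mass at least \<open>t * 2 powr (r * m)\<close> by \<open>q\<close>-th
  moments gives O(t^-q) code points over all levels, and the error integral is O(t) times that
  number; then t is eliminated. At \<open>q = D / (r + D)\<close> the lines \<open>r q\<close> and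
  \<open>D (1 - q)\<close> cross and the exponent equals \<open>D\<close>. A strict gap there allows
  \<open>q\<close> to move a little to the left, and the exponent, being increasing in
  \<open>q\<close>, drops below \<open>D\<close>.\<close>

definition dyadic_index :: "nat \<Rightarrow> real ^ 'd \<Rightarrow> int ^ 'd" where
  "dyadic_index n x = (\<chi> i. \<lceil>2 ^ n * x $ i\<rceil> - 1)"

text \<open>The cubes are open on the left and closed on the right, hence ceiling minus one instead
  of the floor. Membership becomes an equation between indices, and disjointness is then
  immediate.\<close>

lemma mem_dyadic_cube_iff: "x \<in> dyadic_cube n k \<longleftrightarrow> dyadic_index n x = k"
proof -
  have "(of_int (k $ i) / 2 ^ n < x $ i \<and> x $ i \<le> (of_int (k $ i) + 1) / 2 ^ n)
      \<longleftrightarrow> \<lceil>2 ^ n * x $ i\<rceil> - 1 = k $ i" for i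
  proof -
    have "\<lceil>2 ^ n * x $ i\<rceil> - 1 = k $ i \<longleftrightarrow> \<lceil>2 ^ n * x $ i\<rceil> = k $ i + 1" by auto
    then show ?thesis by (simp add: ceiling_eq_iff field_simps)
  qed
  then show ?thesis
    by (simp add: dyadic_cube_def dyadic_index_def vec_eq_iff)
qed

lemma dyadic_cube_nonempty: "dyadic_cube n k \<noteq> {}"
proof -
  have "(\<chi> i. (of_int (k $ i) + 1) / 2 ^ n) \<in> dyadic_cube n k"
    by (auto simp: dyadic_cube_def divide_strict_right_mono)
  then show ?thesis by blast
qed

lemma inj_dyadic_cube: "inj (dyadic_cube n)"
proof (rule injI)
  fix k l :: "int ^ 'd" assume "dyadic_cube n k = dyadic_cube n l"
  then show "k = l" using dyadic_cube_nonempty[of n k] by (metis all_not_in_conv mem_dyadic_cube_iff)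
qed

lemma borel_dyadic_cube [measurable]:
  fixes k :: "int ^ 'd"
  shows "dyadic_cube n k \<in> sets borel"
proof -
  have "dyadic_cube n k =
    (\<Inter>i. {x. of_int (k $ i) / 2 ^ n < x $ i} \<inter> {x. x $ i \<le> (of_int (k $ i) + 1) / 2 ^ n})"
    by (auto simp: dyadic_cube_def)
  moreover have "{x :: real ^ 'd. of_int (k $ i) / 2 ^ n < x $ i} \<inter> {x. x $ i \<le> (of_int (k $ i) + 1) / 2 ^ n}
      \<in> sets borel" for i
    by (rule sets.Int[OF borel_open[OF open_halfspace_component_gt_cart]
          borel_closed[OF closed_halfspace_component_le_cart]])
  ultimately show ?thesis by (simp add: sets.finite_INT)
qed

text \<open>With m the ceiling of y, 2y lies in (2m - 2, 2m], so the index of 2y is 2m - 2 or 2m -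
  1, and halving either gives m - 1. Thus the cubes are nested and \<open>div 2\<close> finds the
  parent.\<close>

lemma dyadic_index_Suc: "dyadic_index n x = (\<chi> i. dyadic_index (Suc n) x $ i div 2)"
proof -
  have *: "\<lceil>y\<rceil> - 1 = (\<lceil>2 * y\<rceil> - 1) div 2" for y :: real
  proof -
    define m where "m = \<lceil>y\<rceil>"
    have "of_int m - 1 < y" "y \<le> of_int m"
      unfolding m_def by linarith+
    then have "\<lceil>2 * y\<rceil> = 2 * m \<or> \<lceil>2 * y\<rceil> = 2 * m - 1"
      by (simp add: ceiling_eq_iff) linarith
    then have "(\<lceil>2 * y\<rceil> - 1) div 2 = m - 1" by presburger
    then show ?thesis by (simp add: m_def)
  qed
  show ?thesis
    using *[of "2 ^ n * x $ i" for i] unfolding dyadic_index_def vec_eq_iff vec_lambda_beta power_Suc mult.assoc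
    by blast
qed

text \<open>The l1 norm dominates the Euclidean norm. This gives \<open>CARD('d)\<close> instead of
  its square root, which is harmless as only exponents matter.\<close>

lemma dist_dyadic_index_le:
  fixes x y :: "real ^ 'd"
  assumes "dyadic_index n x = dyadic_index n y"
  shows "dist x y \<le> real CARD('d) / 2 ^ n"
proof -
  have "\<bar>(x - y) $ i\<bar> \<le> 1 / 2 ^ n" for i
  proof -
    have "\<lceil>2 ^ n * x $ i\<rceil> = \<lceil>2 ^ n * y $ i\<rceil>"
      using assms by (simp add: dyadic_index_def vec_eq_iff)
    then have "\<bar>2 ^ n * x $ i - 2 ^ n * y $ i\<bar> \<le> 1" by linarith
    then have "2 ^ n * \<bar>x $ i - y $ i\<bar> \<le> 1"
      by (simp add: abs_mult flip: right_diff_distrib)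
    then show ?thesis by (simp add: field_simps)
  qed
  then have "(\<Sum>i\<in>UNIV. \<bar>(x - y) $ i\<bar>) \<le> (\<Sum>i\<in>(UNIV::'d set). 1 / 2 ^ n)"
    by (intro sum_mono)
  then show ?thesis
    using norm_le_l1_cart[of "x - y"] by (simp add: dist_norm)
qed

text \<open>Mostly a separation statement: points whose cubes are not adjacent are more than
  \<open>1 / 2 ^ n\<close> apart. It controls both how many cubes a small set can meet and how many
  a code point can serve.\<close>

lemma dyadic_index_neighbours:
  fixes x y :: "real ^ 'd"
  assumes "dist x y \<le> 1 / 2 ^ n"
  shows "\<bar>dyadic_index n x $ i - dyadic_index n y $ i\<bar> \<le> 1"
proof -
  have ceiling_near: "\<bar>\<lceil>a\<rceil> - \<lceil>b\<rceil>\<bar> \<le> 1" if "\<bar>a - b\<bar> \<le> 1" for a b :: real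
    using that by linarith
  have "\<bar>x $ i - y $ i\<bar> \<le> 1 / 2 ^ n"
    using assms component_le_norm_cart[of "x - y" i] by (simp add: dist_norm)
  then have "2 ^ n * \<bar>x $ i - y $ i\<bar> \<le> 1"
    by (simp add: field_simps)
  then have "\<bar>2 ^ n * x $ i - 2 ^ n * y $ i\<bar> \<le> 1"
    by (simp add: abs_mult flip: right_diff_distrib)
  then show ?thesis
    using ceiling_near by (simp add: dyadic_index_def)
qed

lemma finite_int_box: "finite {k :: int ^ 'd. \<forall>i. a i \<le> k $ i \<and> k $ i \<le> b i}"
proof (rule finite_subset)
  show "{k :: int ^ 'd. \<forall>i. a i \<le> k $ i \<and> k $ i \<le> b i} \<subseteq> vec_lambda ` (PiE UNIV (\<lambda>i. {a i..b i}))"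
  proof
    fix k :: "int ^ 'd" assume "k \<in> {k. \<forall>i. a i \<le> k $ i \<and> k $ i \<le> b i}"
    then have "k = vec_lambda (vec_nth k)" "vec_nth k \<in> PiE UNIV (\<lambda>i. {a i..b i})"
      by auto
    then show "k \<in> vec_lambda ` (PiE UNIV (\<lambda>i. {a i..b i}))" by blast
  qed
qed (simp add: finite_PiE)

text \<open>The cardinality of this block is never evaluated: only its translation invariance and
  positivity enter, and \<open>card (neighbours 0)\<close> is the dimensional constant.\<close>

definition neighbours :: "int ^ 'd \<Rightarrow> (int ^ 'd) set" where
  "neighbours l = {k. \<forall>i. \<bar>k $ i - l $ i\<bar> \<le> 1}"

lemma finite_neighbours [simp]: "finite (neighbours l)"
  by (rule finite_subset[OF _ finite_int_box[of "\<lambda>i. l $ i - 1" "\<lambda>i. l $ i + 1"]])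
    (auto simp: neighbours_def abs_le_iff, smt+)

lemma card_neighbours: "card (neighbours (l :: int ^ 'd)) = card (neighbours (0 :: int ^ 'd))"
proof (rule bij_betw_same_card[of "\<lambda>k. k - l"])
  show "bij_betw (\<lambda>k. k - l) (neighbours l) (neighbours 0)"
    by (rule bij_betw_byWitness[of _ "\<lambda>k. k + l"]) (auto simp: neighbours_def)
qed

lemma card_neighbours_pos: "card (neighbours (0 :: int ^ 'd)) > 0"
  by (subst card_gt_0_iff) (auto simp: neighbours_def simp del: finite_neighbours
      intro: exI[of _ 0] finite_neighbours[unfolded neighbours_def, of 0, simplified])

text \<open>A child has coordinates 2l or 2l + 1, within 1 of 2l. So the constant for adjacency also
  bounds the branching of the dyadic tree.\<close>

lemma children_subset_neighbours: "{k. (\<chi> i. k $ i div 2) = l} \<subseteq> neighbours (\<chi> i. 2 * l $ i)"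
  by (auto simp: neighbours_def)

lemma card_UN_neighbours_le:
  fixes K :: "'a set" and f :: "'a \<Rightarrow> int ^ 'd"
  assumes "finite K"
  shows "card (\<Union>l\<in>K. neighbours (f l)) \<le> card K * card (neighbours (0 :: int ^ 'd))"
proof -
  have "card (\<Union>l\<in>K. neighbours (f l)) \<le> (\<Sum>l\<in>K. card (neighbours (f l)))"
    by (rule card_UN_le[OF assms])
  then show ?thesis by (simp add: card_neighbours[of "f _"] mult.commute)
qed

subsection \<open>Cube masses\<close>

locale compact_support_prob = prob_space \<nu> for \<nu> :: "(real ^ 'd) measure" +
  assumes sets_eq_borel: "sets \<nu> = sets borel"
    and compact_support: "compact (measure_support \<nu>)"
begin

lemma space_eq [simp]: "space \<nu> = UNIV"
  using sets_eq_imp_space_eq[OF sets_eq_borel] by simp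

lemma dyadic_cube_in_sets [simp, measurable]: "dyadic_cube n k \<in> sets \<nu>"
  by (simp add: sets_eq_borel borel_dyadic_cube)

text \<open>By second countability the complement of the support is covered by countably many null
  basic open sets.\<close>

lemma AE_in_support: "AE x in \<nu>. x \<in> measure_support \<nu>"
proof -
  obtain B :: "(real ^ 'd) set set" where B: "countable B" "topological_basis B"
    using ex_countable_basis by blast
  define N where "N = \<Union>{b \<in> B. emeasure \<nu> b = 0}"
  have "N \<in> null_sets \<nu>" unfolding N_def
    using B by (intro null_sets_UN'[where N = "\<lambda>b. b", simplified])
      (auto simp: sets_eq_borel topological_basis_open)
  moreover have "x \<in> N" if out: "x \<notin> measure_support \<nu>" for x
  proof -
    obtain U where U: "open U" "x \<in> U" "emeasure \<nu> U = 0"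
      using out by (auto simp: measure_support_def)
    then obtain b where b: "b \<in> B" "x \<in> b" "b \<subseteq> U"
      using B(2) topological_basisE by metis
    moreover have "emeasure \<nu> b \<le> emeasure \<nu> U"
      using b U by (intro emeasure_mono) (auto simp: sets_eq_borel)
    ultimately show ?thesis using U by (auto simp: N_def)
  qed
  ultimately show ?thesis
    by (intro AE_I'[of N]) auto
qed

definition mass :: "nat \<Rightarrow> int ^ 'd \<Rightarrow> real" where
  "mass n k = measure \<nu> (dyadic_cube n k)"

definition charged :: "nat \<Rightarrow> (int ^ 'd) set" where
  "charged n = {k. mass n k > 0}"

lemma mass_nonneg [simp]: "mass n k \<ge> 0"
  by (simp add: mass_def)

lemma mass_le_1 [simp]: "mass n k \<le> 1"
  by (simp add: mass_def)

lemma mass_not_charged: "k \<notin> charged n \<Longrightarrow> mass n k = 0"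
  using mass_nonneg[of n k] by (simp add: charged_def not_less)

section \<open>Charged cubes: finiteness, total mass and growth\<close>

lemma charged_meets_support:
  assumes "k \<in> charged n"
  shows "\<exists>x \<in> measure_support \<nu>. dyadic_index n x = k"
proof (rule ccontr)
  assume *: "\<not> ?thesis"
  from AE_in_support have "AE x in \<nu>. x \<notin> dyadic_cube n k"
    by eventually_elim (use * in \<open>auto simp: mem_dyadic_cube_iff\<close>)
  then have "prob (dyadic_cube n k) = 0"
    by (subst prob_eq_0) auto
  then show False using assms by (simp add: charged_def mass_def)
qed

lemma finite_index_image:
  assumes "bounded A"
  shows "finite (dyadic_index n ` (A :: (real ^ 'd) set))"
proof -
  obtain R where R: "\<And>x. x \<in> A \<Longrightarrow> norm x \<le> R"
    using assms by (auto simp: bounded_iff)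
  have "dyadic_index n ` A \<subseteq> {k. \<forall>i. \<lceil>- (2 ^ n * R)\<rceil> - 1 \<le> k $ i \<and> k $ i \<le> \<lceil>2 ^ n * R\<rceil>}"
  proof (intro image_subsetI CollectI allI)
    fix x i assume "x \<in> A"
    then have "\<bar>x $ i\<bar> \<le> R" using R component_le_norm_cart[of x i] by force
    then have "x $ i \<le> R" "- R \<le> x $ i" by linarith+
    then have "2 ^ n * x $ i \<le> 2 ^ n * R" "2 ^ n * (- R) \<le> 2 ^ n * x $ i"
      by (intro mult_left_mono; simp add: \<open>x $ i \<le> R\<close> \<open>- R \<le> x $ i\<close>)+
    then have "\<lceil>2 ^ n * x $ i\<rceil> \<le> \<lceil>2 ^ n * R\<rceil>" "\<lceil>- (2 ^ n * R)\<rceil> \<le> \<lceil>2 ^ n * x $ i\<rceil>"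
      using ceiling_mono[of "2 ^ n * x $ i" "2 ^ n * R"]
        ceiling_mono[of "2 ^ n * (- R)" "2 ^ n * x $ i"] by simp_all
    then show "\<lceil>- (2 ^ n * R)\<rceil> - 1 \<le> dyadic_index n x $ i \<and> dyadic_index n x $ i \<le> \<lceil>2 ^ n * R\<rceil>"
      by (simp add: dyadic_index_def)
  qed
  then show ?thesis
    by (rule finite_subset[OF _ finite_int_box])
qed

lemma finite_charged [simp]: "finite (charged n)"
proof (rule finite_subset)
  show "charged n \<subseteq> dyadic_index n ` measure_support \<nu>"
    using charged_meets_support by blast
qed (use compact_support compact_imp_bounded finite_index_image in blast)

text \<open>Almost every point is in the support, and the support meets only finitely many uncharged
  cubes, each of them null.\<close>

lemma AE_index_charged: "AE x in \<nu>. dyadic_index n x \<in> charged n"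
proof -
  let ?K = "dyadic_index n ` measure_support \<nu> - charged n"
  have fin: "finite ?K"
    using finite_index_image compact_support compact_imp_bounded by blast
  have "AE x in \<nu>. \<forall>k\<in>?K. dyadic_index n x \<noteq> k"
  proof (rule AE_finite_allI[OF fin])
    fix k assume "k \<in> ?K"
    then have "mass n k = 0"
      by (simp add: mass_not_charged)
    then have "AE x in \<nu>. x \<notin> dyadic_cube n k"
      by (subst prob_eq_0[symmetric]) (auto simp: mass_def)
    then show "AE x in \<nu>. dyadic_index n x \<noteq> k" by (simp add: mem_dyadic_cube_iff)
  qed
  with AE_in_support show ?thesis by eventually_elim auto
qed

lemma dyadic_cube_disjoint: "disjoint_family_on (dyadic_cube n) K"
  by (auto simp: disjoint_family_on_def mem_dyadic_cube_iff)

lemma measure_UN_dyadic_cube: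
  "finite K \<Longrightarrow> measure \<nu> (\<Union>k\<in>K. dyadic_cube n k) = (\<Sum>k\<in>K. mass n k)"
  unfolding mass_def by (rule finite_measure_finite_Union) (auto simp: dyadic_cube_disjoint)

lemma sum_mass_charged: "(\<Sum>k\<in>charged n. mass n k) = 1"
proof -
  have "AE x in \<nu>. x \<in> (\<Union>k\<in>charged n. dyadic_cube n k)"
    using AE_index_charged[of n] by eventually_elim (auto simp: mem_dyadic_cube_iff)
  then have "prob (\<Union>k\<in>charged n. dyadic_cube n k) = 1"
    by (subst prob_eq_1) auto
  then show ?thesis by (simp add: measure_UN_dyadic_cube)
qed

lemma charged_nonempty [simp]: "charged n \<noteq> {}"
  using sum_mass_charged[of n] by auto

lemma charged_Suc_parent:
  assumes "k \<in> charged (Suc n)"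
  shows "(\<chi> i. k $ i div 2) \<in> charged n"
proof -
  have "dyadic_cube (Suc n) k \<subseteq> dyadic_cube n (\<chi> i. k $ i div 2)"
    using dyadic_index_Suc by (auto simp: mem_dyadic_cube_iff)
  then have "mass (Suc n) k \<le> mass n (\<chi> i. k $ i div 2)"
    unfolding mass_def by (intro finite_measure_mono) auto
  then show ?thesis using assms by (simp add: charged_def)
qed

lemma card_charged_Suc:
  "card (charged (Suc n)) \<le> card (charged n) * card (neighbours (0 :: int ^ 'd))"
proof -
  have "charged (Suc n) \<subseteq> (\<Union>l\<in>charged n. neighbours (\<chi> i. 2 * l $ i))"
    using charged_Suc_parent children_subset_neighbours by blast
  then have "card (charged (Suc n)) \<le> card (\<Union>l\<in>charged n. neighbours (\<chi> i. 2 * l $ i))"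
    by (intro card_mono) auto
  also have "\<dots> \<le> card (charged n) * card (neighbours (0 :: int ^ 'd))"
    by (rule card_UN_neighbours_le) simp
  finally show ?thesis .
qed

text \<open>Crude exponential growth, whose purpose is to make the spectrum finite.\<close>

lemma card_charged_le:
  "card (charged n) \<le> card (charged 0) * card (neighbours (0 :: int ^ 'd)) ^ n"
proof (induction n)
  case (Suc n)
  then have "card (charged n) * card (neighbours (0 :: int ^ 'd))
      \<le> (card (charged 0) * card (neighbours (0 :: int ^ 'd)) ^ n) * card (neighbours (0 :: int ^ 'd))"
    by (rule mult_right_mono) simp
  with card_charged_Suc[of n] show ?case unfolding power_Suc by (simp only: ac_simps)
qed simp

subsection \<open>The \<open>L\<^sup>q\<close>-spectrum on \<open>[0, 1]\<close>\<close>

text \<open>The partition function of multifractal analysis. Summing over charged cubes only agrees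
  with the convention \<open>0 powr 0 = 0\<close>, so the case \<open>q = 0\<close> counts these
  cubes.\<close>

definition zeta :: "nat \<Rightarrow> real \<Rightarrow> real" where
  "zeta n q = (\<Sum>k\<in>charged n. mass n k powr q)"

lemma infsum_dyadic_cubes_eq_zeta: "(\<Sum>\<^sub>\<infinity>C\<in>dyadic_cubes n. measure \<nu> C powr q) = zeta n q"
proof -
  have "(\<Sum>\<^sub>\<infinity>C\<in>dyadic_cubes n. measure \<nu> C powr q) = (\<Sum>\<^sub>\<infinity>k\<in>UNIV. mass n k powr q)"
    unfolding dyadic_cubes_def
    by (subst infsum_reindex[OF inj_dyadic_cube]) (simp add: o_def mass_def)
  also have "\<dots> = (\<Sum>\<^sub>\<infinity>k\<in>charged n. mass n k powr q)"
  proof (rule infsum_cong_neutral)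
    fix k assume "k \<in> UNIV - charged n"
    then have "mass n k = 0"
      by (simp add: mass_not_charged)
    then show "mass n k powr q = 0" by simp
  qed auto
  finally show ?thesis by (simp add: zeta_def)
qed

lemma zeta_pos: "zeta n q > 0"
  unfolding zeta_def
proof (rule sum_pos)
  show "mass n k powr q > 0" if "k \<in> charged n" for k
    using that by (simp add: charged_def)
qed auto

lemma zeta_1: "zeta n 1 = 1"
  by (simp add: zeta_def sum_mass_charged)

lemma zeta_0: "zeta n 0 = real (card (charged n))"
  by (simp add: zeta_def charged_def)

lemma zeta_ge_1:
  assumes "q \<le> 1" shows "zeta n q \<ge> 1"
proof -
  have "(\<Sum>k\<in>charged n. mass n k) \<le> zeta n q"
    unfolding zeta_def
  proof (rule sum_mono)
    fix k assume "k \<in> charged n"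
    then have "mass n k powr 1 \<le> mass n k powr q"
      using assms by (intro powr_mono') (auto simp: charged_def)
    then show "mass n k \<le> mass n k powr q" by simp
  qed
  then show ?thesis by (simp add: sum_mass_charged)
qed

lemma zeta_le_card:
  assumes "q \<ge> 0" shows "zeta n q \<le> card (charged n)"
proof -
  have "zeta n q \<le> (\<Sum>k\<in>charged n. 1)"
    unfolding zeta_def using assms by (intro sum_mono) (auto intro: powr_le1)
  then show ?thesis by simp
qed

lemma lq_spectrum_eq:
  "lq_spectrum \<nu> q = limsup (\<lambda>n. ereal (log 2 (zeta n q) / n))"
  unfolding lq_spectrum_def infsum_dyadic_cubes_eq_zeta
  by (simp add: log_def ln_realpow field_simps)

lemma eventually_zeta_le:
  assumes "lq_spectrum \<nu> q < ereal b"
  shows "eventually (\<lambda>n. zeta n q \<le> 2 powr (b * real n)) sequentially"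
proof -
  have "eventually (\<lambda>n. ereal (log 2 (zeta n q) / n) < ereal b) sequentially"
    using assms unfolding lq_spectrum_eq by (rule Limsup_lessD)
  with eventually_gt_at_top[of 0] show ?thesis
  proof eventually_elim
    case (elim n)
    then have "log 2 (zeta n q) \<le> b * n" by (simp add: field_simps)
    then show ?case using zeta_pos[of n q] by (simp add: log_le_iff)
  qed
qed

lemma lq_spectrum_leI:
  assumes "eventually (\<lambda>n. zeta n q \<le> 2 powr (b * real n)) sequentially"
  shows "lq_spectrum \<nu> q \<le> ereal b"
  unfolding lq_spectrum_eq
proof (rule Limsup_bounded)
  show "eventually (\<lambda>n. ereal (log 2 (zeta n q) / n) \<le> ereal b) sequentially"
    using assms eventually_gt_at_top[of 0]
  proof eventually_elim
    case (elim n)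
    then show ?case using zeta_pos[of n q] by (simp add: log_le_iff field_simps)
  qed
qed

lemma frequently_zeta_ge:
  assumes "ereal b < lq_spectrum \<nu> q"
  shows "frequently (\<lambda>n. zeta n q > 2 powr (b * real n)) sequentially"
  using assms lq_spectrum_leI[of q b] by (auto simp: frequently_def not_less)

lemma lq_spectrum_nonneg: "q \<le> 1 \<Longrightarrow> lq_spectrum \<nu> q \<ge> 0"
  unfolding lq_spectrum_eq
  by (rule le_Limsup) (auto intro!: always_eventually divide_nonneg_nonneg simp: zeta_ge_1 zero_le_log_cancel_iff zeta_pos)

lemma lq_spectrum_finite:
  assumes "q \<ge> 0"
  shows "lq_spectrum \<nu> q < \<infinity>"
proof -
  define M where "M = real (card (neighbours (0 :: int ^ 'd)))"
  define c where "c = real (card (charged 0))"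
  have M: "M \<ge> 1" using card_neighbours_pos[where 'd = 'd] by (simp add: M_def)
  have "card (charged 0) > 0" by (simp add: card_gt_0_iff)
  then have c: "c \<ge> 1" by (simp add: c_def)
  have "lq_spectrum \<nu> q \<le> ereal (log 2 c + log 2 M)"
  proof (rule lq_spectrum_leI, rule eventually_mono[OF eventually_gt_at_top[of 0]])
    fix n :: nat assume n: "n > 0"
    have "real (card (charged n)) \<le> c * M ^ n"
      using of_nat_mono[OF card_charged_le[of n], where 'a = real] by (simp add: c_def M_def)
    then have "zeta n q \<le> c * M ^ n"
      using zeta_le_card[OF assms, of n] by simp
    \<comment> \<open>For \<open>n > 0\<close> the prefactor \<open>c \<ge> 1\<close> is absorbed
      into a power, so that the bound is purely exponential.\<close>
    also have "\<dots> \<le> c ^ n * M ^ n"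
      using M c n by (intro mult_right_mono) (auto simp: self_le_power)
    also have "\<dots> = 2 powr ((log 2 c + log 2 M) * n)"
      using M c by (simp add: powr_add powr_powr[symmetric] powr_realpow power_mult_distrib distrib_right)
    finally show "zeta n q \<le> 2 powr ((log 2 c + log 2 M) * n)" .
  qed
  then show ?thesis by (rule order.strict_trans1) simp
qed

text \<open>Real-valued so that convexity and derivatives make sense; faithful on
  \<open>{0..1}\<close>, where the spectrum is finite. Its body is the function differentiated in
  statement (3).\<close>

definition beta :: "real \<Rightarrow> real" where
  "beta q = real_of_ereal (lq_spectrum \<nu> q)"

lemma lq_spectrum_eq_beta: "0 \<le> q \<Longrightarrow> q \<le> 1 \<Longrightarrow> lq_spectrum \<nu> q = ereal (beta q)"
  using lq_spectrum_nonneg[of q] lq_spectrum_finite[of q]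
  unfolding beta_def by (cases "lq_spectrum \<nu> q") auto

lemma beta_1 [simp]: "beta 1 = 0"
  by (simp add: beta_def lq_spectrum_eq zeta_1 zero_ereal_def[symmetric] Limsup_const)

text \<open>Log-convexity of \<open>zeta n\<close>, by the standard proof of Hoelder's inequality:
  both sums are normalised to 1 and Young's inequality is applied to each summand.\<close>

lemma zeta_Holder:
  assumes "0 < u" "u < 1"
  shows "zeta n ((1 - u) * p + u * q) \<le> zeta n p powr (1 - u) * zeta n q powr u"
proof -
  let ?A = "zeta n p" and ?B = "zeta n q"
  note pos = zeta_pos[of n p] zeta_pos[of n q]
  have le: "mass n k powr ((1 - u) * p + u * q)
      \<le> ?A powr (1 - u) * ?B powr u * ((1 - u) * (mass n k powr p / ?A) + u * (mass n k powr q / ?B))"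
    if k: "k \<in> charged n" for k
  proof -
    let ?m = "mass n k"
    have m: "?m > 0" using k by (simp add: charged_def)
    have "?m powr ((1 - u) * p + u * q) = (?m powr p) powr (1 - u) * (?m powr q) powr u"
      by (simp add: powr_powr powr_add mult.commute)
    also have "\<dots> = ?A powr (1 - u) * ?B powr u
        * ((?m powr p / ?A) powr (1 - u) * (?m powr q / ?B) powr u)"
      using m pos by (simp add: powr_divide)
    also have "\<dots> \<le> ?A powr (1 - u) * ?B powr u
        * ((1 - u) * (?m powr p / ?A) + u * (?m powr q / ?B))"
      using assms m pos by (intro mult_left_mono Youngs_inequality_0) auto
    finally show ?thesis .
  qed
  have "zeta n ((1 - u) * p + u * q)
      \<le> (\<Sum>k\<in>charged n. ?A powr (1 - u) * ?B powr u
          * ((1 - u) * (mass n k powr p / ?A) + u * (mass n k powr q / ?B)))"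
    unfolding zeta_def[of n "(1 - u) * p + u * q"] by (rule sum_mono) (rule le)
  also have "\<dots> = ?A powr (1 - u) * ?B powr u
      * ((1 - u) * ((\<Sum>k\<in>charged n. mass n k powr p) / ?A)
        + u * ((\<Sum>k\<in>charged n. mass n k powr q) / ?B))"
    by (simp add: sum.distrib sum_divide_distrib sum_distrib_left distrib_left)
  also have "\<dots> = ?A powr (1 - u) * ?B powr u * ((1 - u) * (?A / ?A) + u * (?B / ?B))"
    by (simp only: zeta_def)
  also have "\<dots> = ?A powr (1 - u) * ?B powr u"
    using pos by simp
  finally show ?thesis .
qed

lemma eventually_zeta_le_beta:
  assumes "0 \<le> q" "q \<le> 1" "e > 0"
  shows "eventually (\<lambda>n. zeta n q \<le> 2 powr ((beta q + e) * real n)) sequentially"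
  using assms by (intro eventually_zeta_le) (simp add: lq_spectrum_eq_beta)

text \<open>Each \<open>log 2 (zeta n q) / n\<close> is convex in \<open>q\<close> by
  \<open>zeta_Holder\<close>, and a limsup of convex functions is convex. The slack \<open>e\<close>
  replaces arithmetic with limsups by eventual bounds.\<close>

lemma convex_on_beta: "convex_on {0..1} beta"
proof (rule convex_onI)
  fix u p q :: real
  assume u: "0 < u" "u < 1" and p: "p \<in> {0..1}" and q: "q \<in> {0..1}"
  let ?r = "(1 - u) * p + u * q"
  have r: "0 \<le> ?r" "?r \<le> 1"
    using u p q by (auto intro: convex_bound_le)
  have "beta ?r \<le> (1 - u) * beta p + u * beta q + e" if "e > 0" for e
  proof -
    have ev: "eventually (\<lambda>n. zeta n p \<le> 2 powr ((beta p + e) * real n)) sequentially"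
      "eventually (\<lambda>n. zeta n q \<le> 2 powr ((beta q + e) * real n)) sequentially"
      using eventually_zeta_le_beta p q that by auto
    have "lq_spectrum \<nu> ?r \<le> ereal ((1 - u) * beta p + u * beta q + e)"
    proof (rule lq_spectrum_leI)
      show "\<forall>\<^sub>F n in sequentially.
          zeta n ?r \<le> 2 powr (((1 - u) * beta p + u * beta q + e) * real n)"
        using ev
      proof (eventually_elim)
        case (elim n)
        have "zeta n ?r \<le> zeta n p powr (1 - u) * zeta n q powr u"
          by (rule zeta_Holder[OF u])
        also have "\<dots> \<le> (2 powr ((beta p + e) * real n)) powr (1 - u)
            * (2 powr ((beta q + e) * real n)) powr u"
          using elim u zeta_pos[of n p] zeta_pos[of n q]
          by (intro mult_mono powr_mono2) auto
        also have "\<dots> = 2 powr (((1 - u) * beta p + u * beta q + e) * real n)"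
          by (simp add: powr_powr algebra_simps flip: powr_add)
        finally show ?case .
      qed
    qed
    then show ?thesis using r by (simp add: lq_spectrum_eq_beta)
  qed
  then show "beta ((1 - u) *\<^sub>R p + u *\<^sub>R q) \<le> (1 - u) * beta p + u * beta q"
    unfolding real_scaleR_def by (rule field_le_epsilon)
qed simp

text \<open>Convexity on [p, 1] together with \<open>beta 1 = 0\<close>. Equivalently, the Renyi
  dimension \<open>beta q / (1 - q)\<close> is nonincreasing.\<close>

lemma beta_chord:
  assumes "0 \<le> p" "p \<le> q" "q \<le> 1" "p < 1"
  shows "beta q \<le> (1 - q) / (1 - p) * beta p"
proof -
  define t where "t = (q - p) / (1 - p)"
  have t: "0 \<le> t" "t \<le> 1" "1 - t = (1 - q) / (1 - p)"
    using assms by (auto simp: t_def field_simps)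
  have "(1 - t) * p + t * 1 = q"
  proof -
    have "t * (1 - p) = q - p" using assms by (simp add: t_def)
    then show ?thesis by (simp add: algebra_simps)
  qed
  with convex_onD[OF convex_on_beta t(1,2), of p 1] show ?thesis
    using assms t(3) by simp
qed

lemma beta_le_linear: "0 \<le> q \<Longrightarrow> q \<le> 1 \<Longrightarrow> beta q \<le> beta 0 * (1 - q)"
  using beta_chord[of 0 q] by (simp add: mult.commute)

lemma beta_nonneg: "0 \<le> q \<Longrightarrow> q \<le> 1 \<Longrightarrow> 0 \<le> beta q"
  using lq_spectrum_nonneg[of q] by (simp add: lq_spectrum_eq_beta)

text \<open>Strictness at one point spreads: to the right of \<open>p\<close> along the chord from
  \<open>p\<close> to 1, to the left along the chord from 0 to \<open>p\<close>.\<close>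

lemma beta_strictly_below_chord:
  assumes p: "0 < p" "p < 1" "beta p < beta 0 * (1 - p)" and q: "0 < q" "q < 1"
  shows "beta q < beta 0 * (1 - q)"
proof (cases "p \<le> q")
  case True
  have "beta q \<le> (1 - q) / (1 - p) * beta p"
    using beta_chord[of p q] True p q by simp
  also have "\<dots> < (1 - q) / (1 - p) * (beta 0 * (1 - p))"
    using p q by (intro mult_strict_left_mono) auto
  also have "\<dots> = beta 0 * (1 - q)" using p by simp
  finally show ?thesis .
next
  case False
  have "beta q \<le> (1 - q / p) * beta 0 + q / p * beta p"
    using convex_onD[OF convex_on_beta, of "q / p" 0 p] False p q by simp
  also have "\<dots> < (1 - q / p) * beta 0 + q / p * (beta 0 * (1 - p))"
    using p q by (intro add_strict_left_mono mult_strict_left_mono) auto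
  also have "\<dots> = beta 0 * (1 - q)" using p by (simp add: field_simps)
  finally show ?thesis .
qed

text \<open>The difference quotients at 1 are \<open>- beta y / (1 - y)\<close>, which by
  \<open>beta_chord\<close> do not decrease as \<open>y\<close> approaches 1.\<close>

lemma left_derivative_ge:
  assumes deriv: "(beta has_real_derivative D) (at_left 1)" and q: "0 \<le> q" "q < 1"
  shows "- beta q / (1 - q) \<le> D"
proof (rule tendsto_lowerbound)
  show "((\<lambda>y. (beta y - beta 1) / (y - 1)) \<longlongrightarrow> D) (at_left 1)"
    using deriv by (simp add: has_field_derivative_iff)
  show "eventually (\<lambda>y. - beta q / (1 - q) \<le> (beta y - beta 1) / (y - 1)) (at_left 1)"
  proof (rule eventually_at_leftI[of q])
    fix y assume y: "y \<in> {q<..<1}"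
    then have "beta y \<le> (1 - y) / (1 - q) * beta q"
      using q by (intro beta_chord) auto
    then show "- beta q / (1 - q) \<le> (beta y - beta 1) / (y - 1)"
      using y q by (simp add: field_simps)
  qed (use q in auto)
qed simp

subsection \<open>The spectrum at \<open>0\<close> is the upper Minkowski dimension\<close>

text \<open>The closed charged cubes have full measure, so their complement is open and null and
  misses the support. Closures matter: a support point may lie on a face that belongs to an
  uncharged cube.\<close>

lemma support_subset_closure: "measure_support \<nu> \<subseteq> (\<Union>k\<in>charged n. closure (dyadic_cube n k))"
proof
  fix x assume x: "x \<in> measure_support \<nu>"
  let ?V = "\<Union>k\<in>charged n. closure (dyadic_cube n k)"
  show "x \<in> ?V"
  proof (rule ccontr)
    assume "x \<notin> ?V"
    moreover have "open (- ?V)" by (intro open_Compl closed_UN) auto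
    ultimately have "emeasure \<nu> (- ?V) > 0" using x by (auto simp: measure_support_def)
    moreover have "AE x in \<nu>. x \<notin> - ?V"
      using AE_index_charged[of n]
    proof eventually_elim
      case (elim x)
      then have "x \<in> dyadic_cube n (dyadic_index n x)" by (simp add: mem_dyadic_cube_iff)
      then show ?case using elim closure_subset by blast
    qed
    then have "- ?V \<in> null_sets \<nu>"
      using \<open>open (- ?V)\<close> by (subst AE_iff_null_sets) (auto simp: sets_eq_borel)
    ultimately show False by auto
  qed
qed

lemma diameter_closure_dyadic_cube:
  "bounded (closure (dyadic_cube n (k :: int ^ 'd)))"
  "diameter (closure (dyadic_cube n (k :: int ^ 'd))) \<le> real CARD('d) / 2 ^ n"
proof -
  have *: "dist x y \<le> real CARD('d) / 2 ^ n"
    if "x \<in> dyadic_cube n k" "y \<in> dyadic_cube n k" for x y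
    using that by (intro dist_dyadic_index_le) (simp add: mem_dyadic_cube_iff)
  have bounded: "bounded (dyadic_cube n k)"
  proof -
    obtain x0 where "x0 \<in> dyadic_cube n k" using dyadic_cube_nonempty[of n k] by blast
    then show ?thesis
      using * unfolding bounded_def by (intro exI[of _ x0] exI[of _ "real CARD('d) / 2 ^ n"]) blast
  qed
  then show "bounded (closure (dyadic_cube n k))" by (rule bounded_closure)
  show "diameter (closure (dyadic_cube n (k :: int ^ 'd))) \<le> real CARD('d) / 2 ^ n"
    unfolding diameter_closure[OF bounded]
    using * by (intro diameter_le) (auto simp: dist_norm)
qed

text \<open>The closed charged cubes are an admissible cover. Their existence also shows that the
  \<open>LEAST\<close> in \<open>covering_number\<close> is attained, so an optimal cover can be
  chosen later.\<close>

lemma covering_number_le: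
  assumes "real CARD('d) / 2 ^ n \<le> \<delta>"
  shows "covering_number \<delta> (measure_support \<nu>) \<le> card (charged n)"
    and "\<exists>\<U>. finite \<U> \<and> card \<U> = covering_number \<delta> (measure_support \<nu>) \<and> measure_support \<nu> \<subseteq> \<Union>\<U>
          \<and> (\<forall>U\<in>\<U>. bounded U \<and> diameter U \<le> \<delta>)"
proof -
  let ?P = "\<lambda>N. \<exists>\<U>. finite \<U> \<and> card \<U> = N \<and> measure_support \<nu> \<subseteq> \<Union>\<U>
          \<and> (\<forall>U\<in>\<U>. bounded U \<and> diameter U \<le> \<delta>)"
  let ?U = "(\<lambda>k. closure (dyadic_cube n k)) ` charged n"
  have *: "?P (card ?U)"
    using support_subset_closure[of n] diameter_closure_dyadic_cube[of n] assms
    by (intro exI[of _ ?U]) (auto intro: order_trans)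
  have "covering_number \<delta> (measure_support \<nu>) \<le> card ?U"
    unfolding covering_number_def by (rule Least_le) (rule *)
  also have "\<dots> \<le> card (charged n)" by (rule card_image_le) simp
  finally show "covering_number \<delta> (measure_support \<nu>) \<le> card (charged n)" .
  show "?P (covering_number \<delta> (measure_support \<nu>))"
    unfolding covering_number_def by (rule LeastI) (rule *)
qed

text \<open>A set of diameter at most \<open>1 / 2 ^ n\<close> meets only cubes adjacent to that of
  any one of its points, here \<open>y U\<close>.\<close>

lemma card_charged_le_covering_number:
  "card (charged n) \<le> covering_number (1 / 2 ^ n) (measure_support \<nu>) * card (neighbours (0 :: int ^ 'd))"
proof -
  \<comment> \<open>A level \<open>m + n\<close> with cubes fine enough to show that a cover at
    scale \<open>1 / 2 ^ n\<close> exists at all.\<close>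
  obtain m where m: "real CARD('d) < 2 ^ m"
    using real_arch_pow[of 2 "real CARD('d)"] by auto
  have "real CARD('d) / 2 ^ (m + n) \<le> 1 / 2 ^ n"
    using m by (simp add: power_add field_simps)
  from covering_number_le(2)[OF this] obtain \<U> where U: "finite \<U>"
    "card \<U> = covering_number (1 / 2 ^ n) (measure_support \<nu>)" "measure_support \<nu> \<subseteq> \<Union>\<U>"
    "\<And>U. U \<in> \<U> \<Longrightarrow> bounded U \<and> diameter U \<le> 1 / 2 ^ n"
    by blast
  define y where "y U = (SOME x. x \<in> U)" for U :: "(real ^ 'd) set"
  have "charged n \<subseteq> (\<Union>U\<in>\<U>. neighbours (dyadic_index n (y U)))"
  proof
    fix k assume "k \<in> charged n"
    then obtain x where x: "x \<in> measure_support \<nu>" "dyadic_index n x = k"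
      using charged_meets_support by blast
    then obtain V where V: "V \<in> \<U>" "x \<in> V" using U(3) by blast
    then have "y V \<in> V" unfolding y_def by (metis someI)
    then have "dist x (y V) \<le> diameter V"
      using U(4) V by (intro diameter_bounded_bound) auto
    then have "dist x (y V) \<le> 1 / 2 ^ n" using U(4)[OF V(1)] by linarith
    then have "k \<in> neighbours (dyadic_index n (y V))"
      using dyadic_index_neighbours x(2) by (auto simp: neighbours_def)
    then show "k \<in> (\<Union>U\<in>\<U>. neighbours (dyadic_index n (y U)))" using V by blast
  qed
  then have "card (charged n) \<le> card (\<Union>U\<in>\<U>. neighbours (dyadic_index n (y U)))"
    using U(1) by (intro card_mono) auto
  also have "\<dots> \<le> card \<U> * card (neighbours (0 :: int ^ 'd))"
    by (rule card_UN_neighbours_le) fact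
  finally show ?thesis by (simp add: U(2))
qed

lemma upper_minkowski_dim_le: "upper_minkowski_dim \<nu> \<le> ereal (beta 0)"
proof (rule ereal_le_epsilon2)
  fix e :: real assume e: "e > 0"
  define b where "b = beta 0 + e"
  define K where "K = real CARD('d)"
  have K: "K \<ge> 1" by (simp add: K_def Suc_le_eq)
  have b: "b > 0" using beta_nonneg[of 0] e by (simp add: b_def)
  obtain n0 where n0: "\<And>n. n \<ge> n0 \<Longrightarrow> zeta n 0 \<le> 2 powr (b * real n)"
    using eventually_zeta_le_beta[of 0 e] e by (auto simp: b_def eventually_sequentially)
  have "upper_minkowski_dim \<nu>
      \<le> Limsup (at_right 0) (\<lambda>\<delta>. ereal (b + b * ln (2 * K) / (- ln \<delta>)))"
    unfolding upper_minkowski_dim_def upper_box_dim_def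
  proof (rule Limsup_mono)
    have "K / 2 ^ n0 > 0" using K by simp
    then have "eventually (\<lambda>\<delta>. \<delta> \<in> {0<..<min (1 / 2) (K / 2 ^ n0)}) (at_right 0)"
      by (intro eventually_at_rightI[of 0 "min (1 / 2) (K / 2 ^ n0)"]) auto
    then show "eventually (\<lambda>\<delta>. ereal (ln (real (covering_number \<delta> (measure_support \<nu>))) / (- ln \<delta>))
        \<le> ereal (b + b * ln (2 * K) / (- ln \<delta>))) (at_right 0)"
    proof eventually_elim
      case (elim \<delta>)
      then have \<delta>: "0 < \<delta>" "\<delta> < 1" "\<delta> < K / 2 ^ n0" by auto
      \<comment> \<open>The coarsest level whose diameter bound \<open>K / 2 ^ n\<close> is at most
        \<delta>. Rounding up costs a factor of at most 2, the source of \<open>ln (2 * K)\<close>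
        in the error term, which vanishes as \<delta> tends to 0.\<close>
      define n where "n = nat \<lceil>log 2 (K / \<delta>)\<rceil>"
      have "2 ^ n0 < K / \<delta>" using \<delta> by (simp add: field_simps)
      then have "real n0 < log 2 (K / \<delta>)"
        using K \<delta> by (subst less_log_iff) (auto simp: powr_realpow)
      then have n: "n \<ge> n0" "log 2 (K / \<delta>) \<le> real n" "real n \<le> log 2 (K / \<delta>) + 1"
        unfolding n_def by linarith+
      have "K / \<delta> \<le> 2 ^ n"
        using n(2) K \<delta> by (simp add: log_le_iff powr_realpow)
      then have "real CARD('d) / 2 ^ n \<le> \<delta>"
        using \<delta> by (simp add: field_simps K_def)
      then have "real (covering_number \<delta> (measure_support \<nu>)) \<le> zeta n 0"
        using covering_number_le(1) by (simp add: zeta_0)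
      also have "\<dots> \<le> 2 powr (b * real n)" using n0 n by blast
      also have "\<dots> \<le> 2 powr (b * (log 2 (K / \<delta>) + 1))"
        using n(3) b by (intro powr_mono mult_left_mono) auto
      finally have *: "real (covering_number \<delta> (measure_support \<nu>)) \<le> 2 powr (b * (log 2 (K / \<delta>) + 1))" .
      have "log 2 (K / \<delta>) + 1 \<ge> 0" using n by linarith
      then have nonneg: "0 \<le> b * (log 2 (K / \<delta>) + 1)" using b by simp
      have "ln (real (covering_number \<delta> (measure_support \<nu>))) \<le> b * (log 2 (K / \<delta>) + 1) * ln 2"
      \<comment> \<open>The value \<open>ln 0 = 0\<close> settles the case of covering number
        0.\<close>
      proof (cases "covering_number \<delta> (measure_support \<nu>) = 0")
        case False
        then have "ln (real (covering_number \<delta> (measure_support \<nu>))) \<le> ln (2 powr (b * (log 2 (K / \<delta>) + 1)))"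
          using * by (subst ln_le_cancel_iff) auto
        then show ?thesis by (simp add: ln_powr)
      qed (use nonneg in simp)
      also have "\<dots> = b * (ln (K / \<delta>) + ln 2)"
        by (simp add: log_def field_simps)
      also have "\<dots> = b * (- ln \<delta>) + b * ln (2 * K)"
        using K \<delta> by (simp add: ln_div ln_mult algebra_simps)
      finally have "ln (real (covering_number \<delta> (measure_support \<nu>))) / (- ln \<delta>)
          \<le> (b * (- ln \<delta>) + b * ln (2 * K)) / (- ln \<delta>)"
        using \<delta> by (intro divide_right_mono) auto
      also have "\<dots> = b + b * ln (2 * K) / (- ln \<delta>)"
        using \<delta> by (simp add: field_simps)
      finally show ?case by simp
    qed
  qed
  also have "\<dots> = ereal b"
  proof (rule lim_imp_Limsup)
    have "((\<lambda>\<delta>. b + b * ln (2 * K) / (- ln \<delta>)) \<longlongrightarrow> b) (at_right 0)"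
      by real_asymp
    then show "((\<lambda>\<delta>. ereal (b + b * ln (2 * K) / (- ln \<delta>))) \<longlongrightarrow> ereal b) (at_right 0)"
      by simp
  qed simp
  finally show "upper_minkowski_dim \<nu> \<le> ereal (beta 0) + ereal e" by (simp add: b_def)
qed

lemma upper_minkowski_dim_ge: "ereal (beta 0) \<le> upper_minkowski_dim \<nu>"
proof (rule ccontr)
  assume "\<not> ?thesis"
  then obtain c c' where c: "upper_minkowski_dim \<nu> < ereal c" "ereal c < ereal c'" "ereal c' < ereal (beta 0)"
    by (metis ereal_dense2 not_le)
  define M where "M = real (card (neighbours (0 :: int ^ 'd)))"
  have M: "M > 0" using card_neighbours_pos[where 'd = 'd] by (simp add: M_def)
  have "eventually (\<lambda>\<delta>. ereal (ln (real (covering_number \<delta> (measure_support \<nu>))) / (- ln \<delta>)) < ereal c) (at_right 0)"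
    using c(1) unfolding upper_minkowski_dim_def upper_box_dim_def by (rule Limsup_lessD)
  moreover have "filterlim (\<lambda>n. 1 / 2 ^ n :: real) (at_right 0) sequentially"
    by real_asymp
  ultimately have ev: "eventually (\<lambda>n. ereal (ln (real (covering_number (1 / 2 ^ n) (measure_support \<nu>)))
      / (- ln (1 / 2 ^ n))) < ereal c) sequentially"
    by (rule eventually_compose_filterlim)
  \<comment> \<open>The gap between \<open>c\<close> and \<open>c'\<close> absorbs the adjacency
    constant \<open>M\<close>.\<close>
  have "eventually (\<lambda>n. 2 powr (c * real n) * M \<le> 2 powr (c' * real n)) sequentially"
  proof -
    have "c' - c > 0" using c(2) by simp
    then have "eventually (\<lambda>n. M \<le> 2 powr ((c' - c) * real n)) sequentially"
      by real_asymp
    then show ?thesis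
    proof eventually_elim
      case (elim n)
      then have "2 powr (c * real n) * M \<le> 2 powr (c * real n) * 2 powr ((c' - c) * real n)"
        by simp
      also have "\<dots> = 2 powr (c' * real n)" by (simp add: algebra_simps flip: powr_add)
      finally show ?case .
    qed
  qed
  with ev eventually_gt_at_top[of 0]
  have "eventually (\<lambda>n. zeta n 0 \<le> 2 powr (c' * real n)) sequentially"
  proof eventually_elim
    case (elim n)
    let ?N = "real (covering_number (1 / 2 ^ n) (measure_support \<nu>))"
    have N: "zeta n 0 \<le> ?N * M"
      using of_nat_mono[OF card_charged_le_covering_number[of n], where 'a = real]
      by (simp add: zeta_0 M_def)
    then have pos: "?N > 0" using zeta_pos[of n 0] M
      by (metis less_le_trans zero_less_mult_pos2 of_nat_0_le_iff)
    have "ln ?N < c * (real n * ln 2)"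
      using elim by (simp add: ln_div ln_realpow field_simps)
    then have "ln ?N \<le> ln (2 powr (c * real n))" by (simp add: ln_powr)
    then have "?N \<le> 2 powr (c * real n)"
      using pos by (subst (asm) ln_le_cancel_iff) auto
    then have "?N * M \<le> 2 powr (c * real n) * M" using M by simp
    with N elim show ?case by linarith
  qed
  then have "lq_spectrum \<nu> 0 \<le> ereal c'" by (rule lq_spectrum_leI)
  then show False using c(3) by (simp add: lq_spectrum_eq_beta)
qed

lemma upper_minkowski_dim_eq_beta: "upper_minkowski_dim \<nu> = ereal (beta 0)"
  using upper_minkowski_dim_le upper_minkowski_dim_ge by (rule antisym)

subsection \<open>Upper bounds for the quantization dimension\<close>

lemma quantization_error_le:
  assumes "finite \<alpha>" "\<alpha> \<noteq> {}" "card \<alpha> \<le> N"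
  shows "quantization_error N r \<nu> \<le> (\<integral>x. infdist x \<alpha> powr r \<partial>\<nu>) powr (1 / r)"
  unfolding quantization_error_def
proof (rule cINF_lower)
  show "bdd_below ((\<lambda>\<alpha>. (\<integral>x. infdist x \<alpha> powr r \<partial>\<nu>) powr (1 / r))
      ` {\<alpha>. finite \<alpha> \<and> 1 \<le> card \<alpha> \<and> card \<alpha> \<le> N})"
    by (intro bdd_belowI[of _ 0]) auto
  show "\<alpha> \<in> {\<alpha>. finite \<alpha> \<and> 1 \<le> card \<alpha> \<and> card \<alpha> \<le> N}"
    using assms by (auto simp: Suc_le_eq card_gt_0_iff)
qed

definition anchor :: "nat \<Rightarrow> int ^ 'd \<Rightarrow> real ^ 'd" where
  "anchor n k = (SOME x. x \<in> dyadic_cube n k)"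

lemma dyadic_index_anchor [simp]: "dyadic_index n (anchor n k) = k"
proof -
  have "\<exists>x. x \<in> dyadic_cube n k" using dyadic_cube_nonempty[of n k] by blast
  then have "anchor n k \<in> dyadic_cube n k" unfolding anchor_def by (rule someI_ex)
  then show ?thesis by (simp add: mem_dyadic_cube_iff)
qed

section \<open>The adaptive codebook and the decay of the error\<close>

lemma integral_cubes:
  assumes "finite I" "\<And>m. m \<in> I \<Longrightarrow> finite (T m)"
  shows "integrable \<nu> (\<lambda>x. \<Sum>m\<in>I. \<Sum>k\<in>T m. c m * indicator (dyadic_cube (Suc m) k) x)"
    and "(\<integral>x. (\<Sum>m\<in>I. \<Sum>k\<in>T m. c m * indicator (dyadic_cube (Suc m) k) x) \<partial>\<nu>)
      = (\<Sum>m\<in>I. \<Sum>k\<in>T m. c m * mass (Suc m) k)"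
proof -
  have *: "integrable \<nu> (\<lambda>x. c m * indicator (dyadic_cube (Suc m) k) x :: real)" for m k
    by (intro integrable_mult_right integrable_real_indicator) (auto simp: emeasure_eq_measure)
  then show "integrable \<nu> (\<lambda>x. \<Sum>m\<in>I. \<Sum>k\<in>T m. c m * indicator (dyadic_cube (Suc m) k) x)"
    by (intro Bochner_Integration.integrable_sum)
  show "(\<integral>x. (\<Sum>m\<in>I. \<Sum>k\<in>T m. c m * indicator (dyadic_cube (Suc m) k) x) \<partial>\<nu>)
      = (\<Sum>m\<in>I. \<Sum>k\<in>T m. c m * mass (Suc m) k)"
    using * by (subst Bochner_Integration.integral_sum, fastforce intro: Bochner_Integration.integrable_sum)
      (simp add: mass_def)
qed

text \<open>The finitely many exceptional levels go into the constant. The codebook draws on every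
  level from 0 on, so an eventual bound would not do.\<close>

lemma zeta_le_uniform:
  assumes "lq_spectrum \<nu> q < ereal b"
  shows "\<exists>C>0. \<forall>n. zeta n q \<le> C * 2 powr (b * real n)"
proof -
  obtain n0 where n0: "\<And>n. n \<ge> n0 \<Longrightarrow> zeta n q \<le> 2 powr (b * real n)"
    using eventually_zeta_le[OF assms] by (auto simp: eventually_sequentially)
  define C where "C = 1 + (\<Sum>n<n0. zeta n q / 2 powr (b * real n))"
  have nonneg: "0 \<le> zeta n q / 2 powr (b * real n)" for n
    using zeta_pos[of n q] by simp
  then have C: "C \<ge> 1" unfolding C_def by (simp add: sum_nonneg)
  have "zeta n q \<le> C * 2 powr (b * real n)" for n
  proof (cases "n < n0")
    case True
    then have "zeta n q / 2 powr (b * real n) \<le> (\<Sum>n<n0. zeta n q / 2 powr (b * real n))"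
      using nonneg by (intro member_le_sum) auto
    then have "zeta n q / 2 powr (b * real n) \<le> C" by (simp add: C_def)
    then show ?thesis by (simp add: field_simps)
  next
    case False
    then have "zeta n q \<le> 1 * 2 powr (b * real n)" using n0 by simp
    also have "\<dots> \<le> C * 2 powr (b * real n)" using C by (intro mult_right_mono) auto
    finally show ?thesis .
  qed
  then show ?thesis using C by (intro exI[of _ C]) auto
qed

text \<open>
  The codebook consists of one point in each cube \<open>k\<close> of level \<open>m\<close> with
  \<open>mass m k \<ge> t * 2 powr (r * m)\<close>. The cubes at which this first fails along the dyadic tree cover
  almost all of the space, and each of them contributes \<open>O(t)\<close> to the error.
\<close>

lemma adaptive_codebook:
  assumes r: "r > 0" and q: "q > 0" and lq: "lq_spectrum \<nu> q < ereal (r * q)"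
  shows "\<exists>c>0. \<exists>t0>0. \<forall>t. 0 < t \<and> t \<le> t0 \<longrightarrow>
    (\<exists>\<alpha>. finite \<alpha> \<and> \<alpha> \<noteq> {} \<and> real (card \<alpha>) \<le> c * t powr (- q)
       \<and> (\<integral>x. infdist x \<alpha> powr r \<partial>\<nu>) \<le> c * t powr (1 - q))"
proof -
  obtain b where b: "lq_spectrum \<nu> q < ereal b" "b < r * q"
    using lq ereal_dense2 by (metis less_ereal.simps(1))
  obtain C where C: "C > 0" "\<And>n. zeta n q \<le> C * 2 powr (b * real n)"
    using zeta_le_uniform[OF b(1)] by blast
  \<comment> \<open>The ratio of the geometric series that bounds the number of code points level by
    level; choosing \<open>b\<close> strictly below \<open>r * q\<close> makes it less than
    1.\<close>
  define \<rho> where "\<rho> = 2 powr (b - r * q)"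
  have \<rho>: "0 < \<rho>" "\<rho> < 1" using b by (auto simp: \<rho>_def powr_less_one)
  define K where "K = real CARD('d)"
  define B where "B = real (card (neighbours (0 :: int ^ 'd)))"
  have K: "K > 0" by (simp add: K_def)
  have B: "B > 0" using card_neighbours_pos[where 'd = 'd] by (simp add: B_def)
  define c1 where "c1 = C / (1 - \<rho>)"
  define c2 where "c2 = B * (2 * K) powr r * c1"
  have c12: "c1 > 0" "c2 > 0" using C K B \<rho> by (auto simp: c1_def c2_def)
  \<comment> \<open>For \<open>t \<le> t0\<close> every charged cube of level 0 passes the
    threshold, so failure along the tree starts at level 1 at the earliest and a parent with a code
    point exists.\<close>
  define t0 where "t0 = Min (mass 0 ` charged 0)"
  have t0: "t0 > 0" unfolding t0_def by (subst Min_gr_iff) (auto simp: charged_def[symmetric], auto simp: charged_def)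
  have "\<exists>\<alpha>. finite \<alpha> \<and> \<alpha> \<noteq> {} \<and> real (card \<alpha>) \<le> max c1 c2 * t powr (- q)
       \<and> (\<integral>x. infdist x \<alpha> powr r \<partial>\<nu>) \<le> max c1 c2 * t powr (1 - q)"
    if t: "0 < t" "t \<le> t0" for t
  proof -
    define P where "P m = {k. mass m k \<ge> t * 2 powr (r * real m)}" for m
    have P_charged: "P m \<subseteq> charged m" for m
      using t unfolding P_def charged_def by (auto intro: less_le_trans[rotated])
    have fin_P [simp]: "finite (P m)" for m
      using P_charged finite_charged finite_subset by blast
    have P0: "P 0 = charged 0"
    proof (rule antisym[OF P_charged], rule subsetI)
      fix k assume "k \<in> charged 0"
      then have "t0 \<le> mass 0 k" unfolding t0_def by (intro Min_le) auto
      then show "k \<in> P 0" using t by (simp add: P_def)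
    qed
    have "eventually (\<lambda>m. t * 2 powr (r * real m) > 1) sequentially"
      using r t(1) by real_asymp
    \<comment> \<open>No mass exceeds 1, so no cube of level \<open>L\<close> passes and only
      finitely many levels contribute.\<close>
    then obtain L where L: "t * 2 powr (r * real L) > 1"
      by (auto simp: eventually_sequentially)
    then have PL: "P L = {}"
      unfolding P_def using le_less_trans[OF mass_le_1[of L] L] by (auto simp: not_le)
    have card_P: "real (card (P m)) \<le> C * t powr (- q) * \<rho> ^ m" for m
    proof -
      \<comment> \<open>Chebyshev's inequality for \<open>q\<close>-th powers.\<close>
      have "real (card (P m)) * (t * 2 powr (r * real m)) powr q = (\<Sum>k\<in>P m. (t * 2 powr (r * real m)) powr q)"
        by simp
      also have "\<dots> \<le> (\<Sum>k\<in>P m. mass m k powr q)"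
        using t q by (intro sum_mono powr_mono2) (auto simp: P_def)
      also have "\<dots> \<le> zeta m q"
        unfolding zeta_def using P_charged by (intro sum_mono2) auto
      also have "\<dots> \<le> C * 2 powr (b * real m)" by (rule C(2))
      finally have "real (card (P m)) \<le> C * 2 powr (b * real m) / (t * 2 powr (r * real m)) powr q"
        using t by (simp add: field_simps)
      also have "\<dots> = C * t powr (- q) * (2 powr (b * real m) / 2 powr (r * real m * q))"
        using t by (simp add: powr_mult powr_powr powr_minus field_simps)
      also have "2 powr (b * real m) / 2 powr (r * real m * q) = \<rho> ^ m"
        unfolding \<rho>_def by (simp add: powr_realpow[symmetric] powr_powr powr_diff[symmetric] algebra_simps)
      finally show ?thesis .
    qed
    have sum_P: "(\<Sum>m<L. real (card (P m))) \<le> c1 * t powr (- q)"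
    proof -
      have "(\<Sum>m<L. real (card (P m))) \<le> (\<Sum>m<L. C * t powr (- q) * \<rho> ^ m)"
        by (intro sum_mono card_P)
      also have "\<dots> = C * t powr (- q) * ((1 - \<rho> ^ L) / (1 - \<rho>))"
        using \<rho> by (simp add: sum_gp_strict flip: sum_distrib_left)
      also have "\<dots> \<le> C * t powr (- q) * (1 / (1 - \<rho>))"
        using \<rho> C by (intro mult_left_mono divide_right_mono) auto
      finally show ?thesis by (simp add: c1_def field_simps)
    qed
    define \<alpha> where "\<alpha> = (\<Union>m<L. anchor m ` P m)"
    have L0: "L > 0" using PL P0 by (cases L) auto
    have \<alpha>: "finite \<alpha>" "\<alpha> \<noteq> {}"
      using L0 P0 charged_nonempty[of 0] by (auto simp: \<alpha>_def simp del: charged_nonempty intro!: bexI[of _ 0])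
    have "card \<alpha> \<le> (\<Sum>m<L. card (anchor m ` P m))"
      unfolding \<alpha>_def by (rule card_UN_le) simp
    also have "\<dots> \<le> (\<Sum>m<L. card (P m))" by (intro sum_mono card_image_le) simp
    finally have "real (card \<alpha>) \<le> (\<Sum>m<L. real (card (P m)))" by (simp flip: of_nat_sum)
    then have card_\<alpha>: "real (card \<alpha>) \<le> c1 * t powr (- q)" using sum_P by linarith
    \<comment> \<open>A superset of the failing children of \<open>P m\<close>, with indices at
      level \<open>Suc m\<close>; taking adjacent indices instead of exact children costs only the
      factor \<open>B\<close>.\<close>
    define T where "T m = (\<Union>l\<in>P m. neighbours (\<chi> i. 2 * l $ i)) - P (Suc m)" for m
    have fin_T [simp]: "finite (T m)" for m by (simp add: T_def)
    have card_T: "real (card (T m)) \<le> B * real (card (P m))" for m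
    proof -
      have "card (T m) \<le> card (\<Union>l\<in>P m. neighbours (\<chi> i. 2 * l $ i))"
        unfolding T_def by (intro card_mono) auto
      also have "\<dots> \<le> card (P m) * card (neighbours (0 :: int ^ 'd))"
        by (rule card_UN_neighbours_le) simp
      finally have "real (card (T m)) \<le> real (card (P m) * card (neighbours (0 :: int ^ 'd)))"
        by (rule of_nat_mono)
      then show ?thesis by (simp add: B_def mult.commute)
    qed
    define f where "f x = (\<Sum>m<L. \<Sum>k\<in>T m. (K / 2 ^ m) powr r * indicator (dyadic_cube (Suc m) k) x)" for x
    have f_int: "integrable \<nu> f" "(\<integral>x. f x \<partial>\<nu>) = (\<Sum>m<L. \<Sum>k\<in>T m. (K / 2 ^ m) powr r * mass (Suc m) k)"
      unfolding f_def by (rule integral_cubes; simp)+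
    have dom: "infdist x \<alpha> powr r \<le> f x" if x: "dyadic_index 0 x \<in> charged 0" for x
    proof -
      let ?bad = "\<lambda>m. dyadic_index m x \<notin> P m"
      \<comment> \<open>The first level at which the path of \<open>x\<close> fails. It is positive
        by \<open>P0\<close>, so the cube one level up is in \<open>P\<close> and contains a code
        point.\<close>
      define m where "m = (LEAST m. ?bad m)"
      have m: "?bad m" "m \<le> L" and least: "\<And>j. j < m \<Longrightarrow> \<not> ?bad j"
        unfolding m_def using LeastI[of ?bad L] Least_le[of ?bad L] not_less_Least PL by auto
      then obtain j where j: "m = Suc j" using x P0 by (cases m) auto
      let ?k = "dyadic_index (Suc j) x" and ?l = "dyadic_index j x"
      have l: "?l \<in> P j" "j < L" using least j m by auto
      have "?k \<in> neighbours (\<chi> i. 2 * ?l $ i)"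
        using children_subset_neighbours[of ?l] dyadic_index_Suc[of j x]
        by (simp add: subset_iff)
      then have k: "?k \<in> T j" using l m j by (auto simp: T_def)
      have "infdist x \<alpha> \<le> dist x (anchor j ?l)"
        using l by (intro infdist_le) (auto simp: \<alpha>_def)
      also have "\<dots> \<le> K / 2 ^ j" unfolding K_def by (intro dist_dyadic_index_le) simp
      finally have "infdist x \<alpha> powr r \<le> (K / 2 ^ j) powr r"
        using r infdist_nonneg by (intro powr_mono2) auto
      also have "\<dots> = (K / 2 ^ j) powr r * indicator (dyadic_cube (Suc j) ?k) x"
        by (simp add: indicator_def mem_dyadic_cube_iff)
      also have "\<dots> \<le> (\<Sum>k\<in>T j. (K / 2 ^ j) powr r * indicator (dyadic_cube (Suc j) k) x)"
        using k by (intro member_le_sum[of ?k]) auto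
      also have "\<dots> \<le> f x" unfolding f_def
        using l by (intro member_le_sum[of j "{..<L}"
              "\<lambda>j. \<Sum>k\<in>T j. (K / 2 ^ j) powr r * indicator (dyadic_cube (Suc j) k) x"])
          (auto intro!: sum_nonneg)
      finally show ?thesis .
    qed
    have "(\<integral>x. infdist x \<alpha> powr r \<partial>\<nu>) \<le> (\<integral>x. f x \<partial>\<nu>)"
    proof (rule integral_mono_AE')
      show "AE x in \<nu>. infdist x \<alpha> powr r \<le> f x"
        using AE_index_charged[of 0] by eventually_elim (rule dom)
      show "AE x in \<nu>. 0 \<le> f x" by (auto simp: f_def intro!: sum_nonneg)
    qed (rule f_int)
    also have "\<dots> \<le> (\<Sum>m<L. \<Sum>k\<in>T m. (2 * K) powr r * t)"
      unfolding f_int(2)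
    proof (intro sum_mono)
      fix m k assume "k \<in> T m"
      then have "mass (Suc m) k \<le> t * 2 powr (r * real (Suc m))"
        by (auto simp: T_def P_def)
      then have "(K / 2 ^ m) powr r * mass (Suc m) k \<le> (K / 2 ^ m) powr r * (t * 2 powr (r * real (Suc m)))"
        by (intro mult_left_mono) auto
      \<comment> \<open>The threshold grows like \<open>2 powr (r * m)\<close> exactly to cancel the
        decay of the \<open>r\<close>-th power of the diameter; the shift by one level leaves the
        factor 2.\<close>
      also have "\<dots> = (2 * K) powr r * t"
      proof -
        have "2 powr (r * real (Suc m)) = (2 ^ Suc m) powr r"
          by (simp only: powr_realpow[of 2, symmetric] powr_powr mult.commute zero_less_numeral)
        then have "(K / 2 ^ m) powr r * 2 powr (r * real (Suc m)) = (K / 2 ^ m * 2 ^ Suc m) powr r"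
          using K by (subst powr_mult) auto
        also have "K / 2 ^ m * 2 ^ Suc m = 2 * K" by simp
        finally show ?thesis by (simp add: algebra_simps)
      qed
      finally show "(K / 2 ^ m) powr r * mass (Suc m) k \<le> (2 * K) powr r * t"
        by simp
    qed
    also have "\<dots> = (\<Sum>m<L. real (card (T m))) * ((2 * K) powr r * t)"
      by (simp add: sum_distrib_right)
    also have "\<dots> \<le> (B * (\<Sum>m<L. real (card (P m)))) * ((2 * K) powr r * t)"
      using t card_T by (intro mult_right_mono) (auto simp: sum_distrib_left intro: sum_mono)
    also have "\<dots> \<le> (B * (c1 * t powr (- q))) * ((2 * K) powr r * t)"
      using t sum_P B by (intro mult_right_mono mult_left_mono) auto
    also have "\<dots> = c2 * (t powr (- q) * t powr 1)"
      using t by (simp add: c2_def)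
    also have "\<dots> = c2 * t powr (1 - q)" by (simp only: powr_add[symmetric]) simp
    finally have int: "(\<integral>x. infdist x \<alpha> powr r \<partial>\<nu>) \<le> c2 * t powr (1 - q)" .
    have "c1 * t powr (- q) \<le> max c1 c2 * t powr (- q)"
      "c2 * t powr (1 - q) \<le> max c1 c2 * t powr (1 - q)"
      by (intro mult_right_mono; simp)+
    with \<alpha> card_\<alpha> int show ?thesis by (intro exI[of _ \<alpha>]) auto
  qed
  moreover have "max c1 c2 > 0" using c12 by simp
  ultimately show ?thesis using t0 by blast
qed

lemma quantization_error_decay:
  assumes r: "r > 0" and q: "0 < q" "q < 1" and lq: "lq_spectrum \<nu> q < ereal (r * q)"
  shows "\<exists>c>0. eventually (\<lambda>N. quantization_error N r \<nu> \<le> c * real N powr (- ((1 - q) / (r * q)))) sequentially"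
proof -
  obtain c t0 where c: "c > 0" and t0: "t0 > 0" and codebook: "\<And>t. 0 < t \<Longrightarrow> t \<le> t0 \<Longrightarrow>
    (\<exists>\<alpha>. finite \<alpha> \<and> \<alpha> \<noteq> {} \<and> real (card \<alpha>) \<le> c * t powr (- q)
       \<and> (\<integral>x. infdist x \<alpha> powr r \<partial>\<nu>) \<le> c * t powr (1 - q))"
    using adaptive_codebook[OF r q(1) lq] by blast
  define s where "s = (1 - q) / q"
  define c' where "c' = (c * (1 / c) powr (- s)) powr (1 / r)"
  have "eventually (\<lambda>N. (real N / c) powr (- (1 / q)) \<le> t0) sequentially"
    using c t0 q by real_asymp
  then have "eventually (\<lambda>N. quantization_error N r \<nu> \<le> c' * real N powr (- ((1 - q) / (r * q)))) sequentially"
    using eventually_gt_at_top[of 0]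
  proof eventually_elim
    case (elim N)
    \<comment> \<open>The solution of \<open>c * t powr (- q) = N\<close>, so that the codebook just
      fits the budget of \<open>N\<close> points.\<close>
    define t where "t = (real N / c) powr (- (1 / q))"
    have t: "0 < t" "t \<le> t0" using elim c by (auto simp: t_def)
    obtain \<alpha> where \<alpha>: "finite \<alpha>" "\<alpha> \<noteq> {}" "real (card \<alpha>) \<le> c * t powr (- q)"
      "(\<integral>x. infdist x \<alpha> powr r \<partial>\<nu>) \<le> c * t powr (1 - q)"
      using codebook[OF t] by blast
    have "c * t powr (- q) = real N"
      using q c elim by (simp add: t_def powr_powr)
    then have "card \<alpha> \<le> N" using \<alpha>(3) by simp
    then have "quantization_error N r \<nu> \<le> (\<integral>x. infdist x \<alpha> powr r \<partial>\<nu>) powr (1 / r)"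
      using \<alpha> by (intro quantization_error_le)
    also have "\<dots> \<le> (c * t powr (1 - q)) powr (1 / r)"
      using \<alpha>(4) r by (intro powr_mono2) auto
    also have "t powr (1 - q) = (real N * (1 / c)) powr (- s)"
      by (simp add: t_def powr_powr s_def)
    also have "\<dots> = (1 / c) powr (- s) * real N powr (- s)"
      using c by (subst powr_mult) auto
    also have "(c * ((1 / c) powr (- s) * real N powr (- s))) powr (1 / r)
        = c' * (real N powr (- s)) powr (1 / r)"
      using c by (simp add: c'_def powr_mult mult.assoc[symmetric])
    also have "(real N powr (- s)) powr (1 / r) = real N powr (- ((1 - q) / (r * q)))"
      by (simp add: powr_powr s_def mult.commute)
    finally show ?case .
  qed
  moreover have "c' > 0" using c by (simp add: c'_def)
  ultimately show ?thesis by blast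
qed

section \<open>From the decay of the error to the dimension\<close>

lemma quantization_error_nonneg: "N > 0 \<Longrightarrow> quantization_error N r \<nu> \<ge> 0"
  unfolding quantization_error_def
  by (rule cINF_greatest) (auto intro: exI[of _ "{0}"])

text \<open>In the lower bound this makes \<open>- ln\<close> of the error eventually positive, so
  that the quotient can be cross-multiplied.\<close>

lemma quantization_error_tendsto_0:
  assumes r: "r > 0" and q: "0 < q" "q < 1" and lq: "lq_spectrum \<nu> q < ereal (r * q)"
  shows "(\<lambda>N. quantization_error N r \<nu>) \<longlonglongrightarrow> 0"
proof -
  obtain c where c: "c > 0"
    "eventually (\<lambda>N. quantization_error N r \<nu> \<le> c * real N powr (- ((1 - q) / (r * q)))) sequentially"
    using quantization_error_decay[OF assms] by blast
  have "(1 - q) / (r * q) > 0" using r q by simp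
  then have "(\<lambda>N. c * real N powr (- ((1 - q) / (r * q)))) \<longlonglongrightarrow> 0"
    by real_asymp
  moreover have "eventually (\<lambda>N. 0 \<le> quantization_error N r \<nu>) sequentially"
    using eventually_gt_at_top[of 0] by eventually_elim (rule quantization_error_nonneg)
  ultimately show ?thesis
    using tendsto_sandwich[OF _ c(2) tendsto_const] by blast
qed

lemma upper_quantization_dim_le:
  assumes r: "r > 0" and q: "0 < q" "q < 1" and lq: "lq_spectrum \<nu> q < ereal (r * q)"
  shows "upper_quantization_dim r \<nu> \<le> ereal (r * q / (1 - q))"
proof -
  define s where "s = (1 - q) / (r * q)"
  have s: "s > 0" using r q by (simp add: s_def)
  obtain c where c: "c > 0"
    "eventually (\<lambda>N. quantization_error N r \<nu> \<le> c * real N powr (- s)) sequentially"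
    using quantization_error_decay[OF assms] by (auto simp: s_def)
  have "upper_quantization_dim r \<nu> \<le> limsup (\<lambda>N. ereal (ln (real N) / (s * ln (real N) - ln c)))"
    unfolding upper_quantization_dim_def
  proof (rule Limsup_mono)
    have "eventually (\<lambda>N. s * ln (real N) - ln c > 0) sequentially"
      using s by real_asymp
    with c(2) eventually_gt_at_top[of 0]
    show "eventually (\<lambda>N. ereal (if quantization_error N r \<nu> = 0 then 0
          else ln (real N) / (- ln (quantization_error N r \<nu>)))
        \<le> ereal (ln (real N) / (s * ln (real N) - ln c))) sequentially"
    proof eventually_elim
      case (elim N)
      show ?case
      proof (cases "quantization_error N r \<nu> = 0")
        case False
        then have pos: "quantization_error N r \<nu> > 0"
          using quantization_error_nonneg[of N r] elim by linarith
        then have "ln (quantization_error N r \<nu>) \<le> ln (c * real N powr (- s))"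
          using elim by simp
        also have "\<dots> = ln c - s * ln (real N)"
          using c elim by (simp add: ln_mult ln_powr)
        finally have "s * ln (real N) - ln c \<le> - ln (quantization_error N r \<nu>)" by simp
        then have "ln (real N) / (- ln (quantization_error N r \<nu>))
            \<le> ln (real N) / (s * ln (real N) - ln c)"
          using elim by (intro divide_left_mono mult_pos_pos) auto
        then show ?thesis using False by simp
      qed (use elim in auto)
    qed
  qed
  also have "\<dots> = ereal (1 / s)"
  proof (rule lim_imp_Limsup)
    have "(\<lambda>N. ln (real N) / (s * ln (real N) - ln c)) \<longlonglongrightarrow> 1 / s"
      unfolding divide_inverse mult_1_left using s by real_asymp
    then show "(\<lambda>N. ereal (ln (real N) / (s * ln (real N) - ln c))) \<longlonglongrightarrow> ereal (1 / s)"
      by simp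
  qed simp
  finally show ?thesis by (simp add: s_def)
qed

text \<open>For \<open>q = x / (r + x)\<close> the two quantities \<open>r q\<close> and \<open>x (1 - q)\<close> coincide.\<close>

lemma lq_spectrum_less_at_quotient:
  assumes "r > 0" "x > beta 0"
  defines "q \<equiv> x / (r + x)"
  shows "0 < q" "q < 1" "lq_spectrum \<nu> q < ereal (r * q)" "r * q / (1 - q) = x"
proof -
  have x: "x > 0" using assms(2) beta_nonneg[of 0] by simp
  show q: "0 < q" "q < 1" using x assms(1) by (auto simp: q_def)
  have 1: "1 - q = r / (r + x)" using x assms(1) by (simp add: q_def field_simps)
  then show "r * q / (1 - q) = x" using x assms(1) by (simp add: q_def)
  have "beta q \<le> beta 0 * (1 - q)" using q by (intro beta_le_linear) auto
  also have "\<dots> < x * (1 - q)" using q assms(2) by simp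
  also have "\<dots> = r * q" unfolding 1 by (simp add: q_def)
  finally show "lq_spectrum \<nu> q < ereal (r * q)"
    using q by (simp add: lq_spectrum_eq_beta)
qed

text \<open>Any \<open>x\<close> slightly above \<open>beta 0\<close> is admissible in the preceding
  lemma, by convexity alone, and is then a bound for the dimension.\<close>

lemma upper_quantization_dim_le_beta_0:
  assumes r: "r > 0"
  shows "upper_quantization_dim r \<nu> \<le> ereal (beta 0)"
proof (rule ereal_le_epsilon2)
  fix e :: real assume "e > 0"
  then have x: "beta 0 + e > beta 0" by simp
  show "upper_quantization_dim r \<nu> \<le> ereal (beta 0) + ereal e"
    using upper_quantization_dim_le[OF r lq_spectrum_less_at_quotient(1-3)[OF r x]]
    unfolding lq_spectrum_less_at_quotient(4)[OF r x] by simp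
qed

lemma upper_quantization_dim_less_beta_0:
  assumes r: "r > 0" and p: "0 < p" "p < 1" "beta p < beta 0 * (1 - p)"
  shows "upper_quantization_dim r \<nu> < ereal (beta 0)"
proof -
  define D where "D = beta 0"
  have D: "D > 0" using p beta_nonneg[of p]
    by (simp add: D_def) (metis less_le_trans diff_gt_0_iff_gt linorder_not_less mult_nonpos_nonneg less_eq_real_def)
  define q0 where "q0 = D / (r + D)"
  have q0: "0 < q0" "q0 < 1" using D r by (auto simp: q0_def)
  have 1: "1 - q0 = r / (r + D)" using D r by (simp add: q0_def field_simps)
  define g where "g = D * (1 - q0) - beta q0"
  have g: "g > 0" using beta_strictly_below_chord[OF p q0] by (simp add: g_def D_def)
  \<comment> \<open>Small enough that the loss \<open>\<epsilon> * D\<close> from moving towards 0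
    stays below the part \<open>(1 - \<epsilon>) * g\<close> of the gap that is kept.\<close>
  define \<epsilon> where "\<epsilon> = g / (2 * (D + g))"
  have \<epsilon>: "0 < \<epsilon>" "\<epsilon> < 1 / 2" "\<epsilon> * D < g / 2"
    using g D by (auto simp: \<epsilon>_def field_simps)
  define q where "q = (1 - \<epsilon>) * q0"
  have q: "0 < q" "q < q0" "q < 1" using q0 \<epsilon> by (auto simp: q_def intro: less_trans[of _ q0])
  have "beta q \<le> \<epsilon> * D + (1 - \<epsilon>) * beta q0"
    using convex_onD[OF convex_on_beta, of "1 - \<epsilon>" 0 q0] \<epsilon> q0 by (simp add: q_def D_def)
  also have "\<dots> = \<epsilon> * D + (1 - \<epsilon>) * (D * (1 - q0)) - (1 - \<epsilon>) * g"
    by (simp add: g_def algebra_simps)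
  also have "\<dots> < (1 - \<epsilon>) * (D * (1 - q0))"
  proof -
    have "1 / 2 * g < (1 - \<epsilon>) * g" using \<epsilon> g by (intro mult_strict_right_mono) auto
    with \<epsilon> show ?thesis by simp
  qed
  also have "\<dots> = r * q" unfolding 1 q_def by (simp add: q0_def)
  finally have "lq_spectrum \<nu> q < ereal (r * q)"
    using q by (simp add: lq_spectrum_eq_beta)
  then have "upper_quantization_dim r \<nu> \<le> ereal (r * q / (1 - q))"
    using r q by (intro upper_quantization_dim_le) auto
  also have "r * q / (1 - q) < r * q0 / (1 - q0)"
    using r q q0 by (intro frac_less) auto
  also have "r * q0 / (1 - q0) = D" unfolding 1 using r D by (simp add: q0_def)
  finally show ?thesis by (simp add: D_def)
qed

subsection \<open>Lower bound for the quantization dimension\<close>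

text \<open>Hoelder's inequality against the constant 1, obtained from Young's inequality with the
  uniform weight \<open>1 / h\<close> as reference.\<close>

lemma sum_powr_mass_le:
  assumes "H \<subseteq> charged n" "H \<noteq> {}" "0 < q" "q < 1"
  shows "(\<Sum>k\<in>H. mass n k powr q) \<le> real (card H) powr (1 - q)"
proof -
  define h where "h = real (card H)"
  have fin: "finite H" using assms(1) finite_charged finite_subset by blast
  have h: "h > 0" using fin assms(2) by (simp add: h_def card_gt_0_iff)
  have "(1 / h) powr (1 - q) * (\<Sum>k\<in>H. mass n k powr q)
      = (\<Sum>k\<in>H. (1 / h) powr (1 - q) * mass n k powr q)"
    by (rule sum_distrib_left)
  also have "\<dots> \<le> (\<Sum>k\<in>H. (1 - q) * (1 / h) + q * mass n k)"
    using assms h by (intro sum_mono Youngs_inequality_0) (auto simp: charged_def)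
  also have "\<dots> = (1 - q) + q * (\<Sum>k\<in>H. mass n k)"
    using h by (simp add: sum.distrib h_def flip: sum_distrib_left)
  also have "(\<Sum>k\<in>H. mass n k) \<le> 1"
    using sum_mono2[OF finite_charged assms(1), of "mass n"] sum_mass_charged[of n] by simp
  then have "(1 - q) + q * (\<Sum>k\<in>H. mass n k) \<le> 1"
    using assms mult_left_mono[of "\<Sum>k\<in>H. mass n k" 1 q] by simp
  finally have "(\<Sum>k\<in>H. mass n k powr q) / h powr (1 - q) \<le> 1"
    using h by (simp add: powr_divide)
  then show ?thesis using h by (simp add: field_simps h_def)
qed

text \<open>Used in two regimes: with \<open>a\<close> slightly above \<open>beta 0\<close> for the
  quantization lower bound, and with \<open>a\<close> below \<open>beta 0\<close> for packing and
  Hausdorff dimension.\<close>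

definition heavy :: "real \<Rightarrow> nat \<Rightarrow> (int ^ 'd) set" where
  "heavy a n = {k \<in> charged n. mass n k \<ge> 2 powr (- (a * real n))}"

text \<open>There are too few charged cubes for the light ones to account for half of
  \<open>zeta n q\<close>. The heavy ones carry the rest, and \<open>sum_powr_mass_le\<close> turns
  their \<open>q\<close>-th moment into a lower bound on their number.\<close>

lemma frequently_many_heavy:
  assumes q: "0 < q" "q < 1" and beta: "beta q \<ge> beta 0 * (1 - q)" and \<eta>: "\<eta> > 0"
  shows "frequently (\<lambda>n. 2 powr ((beta 0 - \<eta>) * real n) \<le> real (card (heavy (beta 0 + \<eta>) n))) sequentially"
proof -
  define D where "D = beta 0"
  \<comment> \<open>The two bounds make \<open>d\<close> and \<open>d'\<close> positive: the first
    makes the light part negligible, the second lets the heavy count reach the exponent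
    \<open>D - \<eta>\<close>.\<close>
  define \<epsilon> where "\<epsilon> = min (q * \<eta> / 4) ((1 - q) * \<eta> / 2)"
  have \<epsilon>: "\<epsilon> > 0" using q \<eta> by (simp add: \<epsilon>_def)
  have "\<epsilon> \<le> q * \<eta> / 4" "\<epsilon> \<le> (1 - q) * \<eta> / 2" "0 < q * \<eta>" "0 < (1 - q) * \<eta>"
    using q \<eta> by (auto simp: \<epsilon>_def)
  then have \<epsilon>': "2 * \<epsilon> < q * \<eta>" "\<epsilon> < (1 - q) * \<eta>" by linarith+
  define A where "A = D * (1 - q) - \<epsilon>"
  have "ereal A < lq_spectrum \<nu> q"
    using q beta \<epsilon> by (simp add: A_def D_def lq_spectrum_eq_beta)
  then have freq: "frequently (\<lambda>n. zeta n q > 2 powr (A * real n)) sequentially"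
    by (rule frequently_zeta_ge)
  have ev1: "eventually (\<lambda>n. zeta n 0 \<le> 2 powr ((D + \<epsilon>) * real n)) sequentially"
    using eventually_zeta_le_beta[of 0 \<epsilon>] \<epsilon> by (simp add: D_def)
  define d where "d = q * \<eta> - 2 * \<epsilon>"
  have d: "d > 0" using \<epsilon>' by (simp add: d_def)
  have ev2: "eventually (\<lambda>n. 2 powr (- (d * real n)) < 1 / 2) sequentially"
    using d by real_asymp
  define d' where "d' = (1 - q) * \<eta> - \<epsilon>"
  have d': "d' > 0" using \<epsilon>' by (simp add: d'_def)
  have ev3: "eventually (\<lambda>n. 2 powr (- (d' * real n)) < 1 / 2) sequentially"
    using d' by real_asymp
  have "eventually (\<lambda>n. zeta n q > 2 powr (A * real n)
      \<longrightarrow> 2 powr ((D - \<eta>) * real n) \<le> real (card (heavy (D + \<eta>) n))) sequentially"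
    using ev1 ev2 ev3
  proof eventually_elim
    case (elim n)
    let ?H = "heavy (D + \<eta>) n"
    have H: "?H \<subseteq> charged n" "finite ?H" by (auto simp: heavy_def)
    show ?case
    proof
      assume big: "zeta n q > 2 powr (A * real n)"
      have "(\<Sum>k\<in>charged n - ?H. mass n k powr q) \<le> (\<Sum>k\<in>charged n - ?H. (2 powr (- ((D + \<eta>) * real n))) powr q)"
        using q by (intro sum_mono powr_mono2) (auto simp: heavy_def)
      also have "\<dots> = real (card (charged n - ?H)) * 2 powr (- ((D + \<eta>) * real n) * q)"
        by (simp add: powr_powr)
      also have "\<dots> \<le> zeta n 0 * 2 powr (- ((D + \<eta>) * real n) * q)"
        unfolding zeta_0 by (intro mult_right_mono of_nat_mono card_mono) auto
      also have "\<dots> \<le> 2 powr ((D + \<epsilon>) * real n) * 2 powr (- ((D + \<eta>) * real n) * q)"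
        using elim by (intro mult_right_mono) auto
      also have "\<dots> = 2 powr (A * real n) * 2 powr (- (d * real n))"
        by (simp add: A_def d_def algebra_simps flip: powr_add)
      also have "\<dots> \<le> 2 powr (A * real n) * (1 / 2)"
        using elim by (intro mult_left_mono) auto
      finally have light: "(\<Sum>k\<in>charged n - ?H. mass n k powr q) \<le> 2 powr (A * real n) * (1 / 2)" .
      have "zeta n q = (\<Sum>k\<in>charged n - ?H. mass n k powr q) + (\<Sum>k\<in>?H. mass n k powr q)"
        unfolding zeta_def using H by (intro sum.subset_diff) auto
      then have heavy_sum: "2 powr (A * real n) * (1 / 2) < (\<Sum>k\<in>?H. mass n k powr q)"
        using light big by linarith
      moreover have "0 < 2 powr (A * real n) * (1 / 2)" by simp
      ultimately have "?H \<noteq> {}" by (metis less_asym sum.empty)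
      then have "2 powr (A * real n) * (1 / 2) \<le> real (card ?H) powr (1 - q)"
        using sum_powr_mass_le[OF H(1) _ q] heavy_sum by fastforce
      moreover have "2 powr ((D - \<eta>) * real n * (1 - q)) = 2 powr (A * real n) * 2 powr (- (d' * real n))"
        by (simp add: A_def d'_def algebra_simps flip: powr_add)
      moreover have "\<dots> \<le> 2 powr (A * real n) * (1 / 2)"
        using elim by (intro mult_left_mono) auto
      ultimately have "2 powr ((D - \<eta>) * real n * (1 - q)) \<le> real (card ?H) powr (1 - q)"
        by linarith
      then have "(2 powr ((D - \<eta>) * real n)) powr (1 - q) \<le> real (card ?H) powr (1 - q)"
        by (simp only: powr_powr)
      then show "2 powr ((D - \<eta>) * real n) \<le> real (card ?H)"
        using q powr_less_mono2[of "1 - q" "real (card ?H)" "2 powr ((D - \<eta>) * real n)"]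
        by (meson diff_gt_0_iff_gt linorder_not_less of_nat_0_le_iff)
    qed
  qed
  with freq show ?thesis unfolding D_def by (rule frequently_rev_mp)
qed

text \<open>Compact support bounds the integrand almost everywhere. Lower bounds on the error depend
  on this, since the Bochner integral of a non-integrable function is 0.\<close>

lemma integrable_infdist_powr:
  assumes "\<alpha> \<noteq> {}" "r > 0"
  shows "integrable \<nu> (\<lambda>x. infdist x \<alpha> powr r)"
proof -
  obtain R where R: "\<And>x. x \<in> measure_support \<nu> \<Longrightarrow> norm x \<le> R"
    using compact_imp_bounded[OF compact_support] by (auto simp: bounded_iff)
  obtain y where y: "y \<in> \<alpha>" using assms by blast
  show ?thesis
  proof (rule integrable_const_bound)
    show "AE x in \<nu>. norm (infdist x \<alpha> powr r) \<le> (R + norm y) powr r"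
      using AE_in_support
    proof eventually_elim
      case (elim x)
      have "infdist x \<alpha> \<le> dist x y" using y by (rule infdist_le)
      also have "\<dots> \<le> R + norm y" using R[OF elim] norm_triangle_ineq4[of x y] by (simp add: dist_norm)
      finally show ?case using assms by (simp add: infdist_nonneg powr_mono2)
    qed
    have "(\<lambda>x. infdist x \<alpha>) \<in> borel_measurable borel"
      by (intro borel_measurable_continuous_onI continuous_intros)
    then show "(\<lambda>x. infdist x \<alpha> powr r) \<in> borel_measurable \<nu>"
      unfolding measurable_cong_sets[OF sets_eq_borel refl] by measurable
  qed
qed

text \<open>Each of the \<open>N\<close> code points is close to only boundedly many cubes, so it serves few of the heavy ones.\<close>

lemma quantization_error_ge:
  assumes r: "r > 0" and N: "N > 0"
    and few: "2 * real (card (neighbours (0 :: int ^ 'd))) * real N \<le> real (card (heavy a n))"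
  shows "(real (card (heavy a n)) / 2 * (1 / 2 ^ n) powr r * 2 powr (- (a * real n))) powr (1 / r)
      \<le> quantization_error N r \<nu>"
  unfolding quantization_error_def
proof (rule cINF_greatest)
  show "{\<alpha> :: (real ^ 'd) set. finite \<alpha> \<and> 1 \<le> card \<alpha> \<and> card \<alpha> \<le> N} \<noteq> {}"
    using N by (auto intro: exI[of _ "{0}"])
  fix \<alpha> :: "(real ^ 'd) set" assume "\<alpha> \<in> {\<alpha>. finite \<alpha> \<and> 1 \<le> card \<alpha> \<and> card \<alpha> \<le> N}"
  then have \<alpha>: "finite \<alpha>" "\<alpha> \<noteq> {}" "card \<alpha> \<le> N" by auto
  define S where "S = (\<Union>y\<in>\<alpha>. neighbours (dyadic_index n y))"
  define G where "G = heavy a n - S"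
  have fin: "finite (heavy a n)" "finite G" "finite S"
    using \<alpha> by (auto simp: heavy_def G_def S_def)
  have "card S \<le> card \<alpha> * card (neighbours (0 :: int ^ 'd))"
    unfolding S_def by (rule card_UN_neighbours_le) (rule \<alpha>)
  also have "\<dots> \<le> N * card (neighbours (0 :: int ^ 'd))" using \<alpha> by simp
  finally have "real (card S) \<le> real N * real (card (neighbours (0 :: int ^ 'd)))"
    using of_nat_mono by fastforce
  moreover have "real (card (heavy a n)) - real (card S) \<le> real (card G)"
    using diff_card_le_card_Diff[OF fin(3), of "heavy a n"] unfolding G_def by linarith
  \<comment> \<open>By \<open>few\<close>, at most half of the heavy cubes are adjacent to the cube
    of a code point.\<close>
  ultimately have card_G: "real (card (heavy a n)) / 2 \<le> real (card G)"
    using few by (simp add: field_simps)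
  have far: "(1 / 2 ^ n) powr r * (\<Sum>k\<in>G. indicator (dyadic_cube n k) x) \<le> infdist x \<alpha> powr r" for x
  proof (cases "dyadic_index n x \<in> G")
    case True
    have "1 / 2 ^ n \<le> infdist x \<alpha>"
      unfolding infdist_notempty[OF \<alpha>(2)]
    proof (rule cINF_greatest[OF \<alpha>(2)])
      fix y assume "y \<in> \<alpha>"
      then have "dyadic_index n x \<notin> neighbours (dyadic_index n y)"
        using True by (auto simp: G_def S_def)
      then show "1 / 2 ^ n \<le> dist x y"
        using dyadic_index_neighbours[of x y n] by (force simp: neighbours_def)
    qed
    then have "(1 / 2 ^ n) powr r \<le> infdist x \<alpha> powr r" using r by (intro powr_mono2) auto
    moreover have "(\<Sum>k\<in>G. indicator (dyadic_cube n k) x) = (1 :: real)"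
      using True fin by (simp add: indicator_def mem_dyadic_cube_iff)
    ultimately show ?thesis by simp
  next
    case False
    then have "(\<Sum>k\<in>G. indicator (dyadic_cube n k) x) = (0 :: real)"
      by (intro sum.neutral) (auto simp: indicator_def mem_dyadic_cube_iff)
    then show ?thesis by simp
  qed
  have ind: "integrable \<nu> (indicator (dyadic_cube n k) :: _ \<Rightarrow> real)" for k
    by (intro integrable_real_indicator) (auto simp: emeasure_eq_measure)
  have "real (card (heavy a n)) / 2 * (1 / 2 ^ n) powr r * 2 powr (- (a * real n))
      \<le> real (card G) * (1 / 2 ^ n) powr r * 2 powr (- (a * real n))"
    using card_G by (intro mult_right_mono) auto
  also have "\<dots> = (1 / 2 ^ n) powr r * (\<Sum>k\<in>G. 2 powr (- (a * real n)))" by simp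
  also have "\<dots> \<le> (1 / 2 ^ n) powr r * (\<Sum>k\<in>G. mass n k)"
    by (intro mult_left_mono sum_mono) (auto simp: G_def heavy_def)
  also have "\<dots> = (\<integral>x. (1 / 2 ^ n) powr r * (\<Sum>k\<in>G. indicator (dyadic_cube n k) x) \<partial>\<nu>)"
    using ind by (simp add: mass_def)
  also have "\<dots> \<le> (\<integral>x. infdist x \<alpha> powr r \<partial>\<nu>)"
    using far ind integrable_infdist_powr[OF \<alpha>(2) r]
    by (intro integral_mono integrable_mult_right Bochner_Integration.integrable_sum) auto
  finally show "(real (card (heavy a n)) / 2 * (1 / 2 ^ n) powr r * 2 powr (- (a * real n))) powr (1 / r)
      \<le> (\<integral>x. infdist x \<alpha> powr r \<partial>\<nu>) powr (1 / r)"
    using r by (intro powr_mono2) auto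
qed

lemma upper_quantization_dim_ge_beta_0:
  assumes r: "r > 0" and q: "0 < q" "q < 1" and beta: "beta q \<ge> beta 0 * (1 - q)"
    and pos: "beta 0 > 0"
  shows "ereal (beta 0) \<le> upper_quantization_dim r \<nu>"
proof (rule ccontr)
  assume "\<not> ?thesis"
  \<comment> \<open>The maximum with 0 makes \<open>c\<close> positive, as the later multiplication
    by \<open>c\<close> requires.\<close>
  then have "max 0 (upper_quantization_dim r \<nu>) < ereal (beta 0)"
    using pos by auto
  then obtain c where "max 0 (upper_quantization_dim r \<nu>) < ereal c" "ereal c < ereal (beta 0)"
    using ereal_dense2 by blast
  then have c: "0 < c" "c < beta 0" "upper_quantization_dim r \<nu> < ereal c" by auto
  define D where "D = beta 0"
  define B where "B = real (card (neighbours (0 :: int ^ 'd)))"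
  have B: "B > 0" using card_neighbours_pos[where 'd = 'd] by (simp add: B_def)
  \<comment> \<open>With about 2^((D - \<eta>) n) points, \<open>- ln\<close> of the error is at
    most about (1 + 2 \<eta> / r) n ln 2. This \<eta> makes \<open>D - \<eta>\<close> exceed
    \<open>c * (1 + 2 * \<eta> / r)\<close> by exactly \<open>(D - c) / 2\<close>.\<close>
  define \<eta> where "\<eta> = (D - c) / (2 * (1 + 2 * c / r))"
  have denom: "1 + 2 * c / r \<ge> 1" using c r by simp
  have \<eta>: "\<eta> > 0" using c denom by (simp add: \<eta>_def D_def)
  have "\<eta> * (1 + 2 * c / r) = (D - c) / 2"
  proof -
    have "x / (2 * w) * w = x / 2" if "w \<ge> 1" for x w :: real
      using that by simp
    then show ?thesis using denom unfolding \<eta>_def by blast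
  qed
  then have gap: "D - \<eta> - c * (1 + 2 * \<eta> / r) = (D - c) / 2"
    by (simp add: algebra_simps)
  define g where "g = (D - c) / 2"
  have g: "g > 0" using c by (simp add: g_def D_def)
  have D\<eta>: "D - \<eta> > 0" using gap g c \<eta> r
    by (smt (verit) divide_pos_pos mult_pos_pos g_def)
  \<comment> \<open>The largest budget for which 2^((D - \<eta>) n) heavy cubes guarantee that half
    of them are missed.\<close>
  define N where "N n = nat \<lfloor>2 powr ((D - \<eta>) * real n) / (2 * B)\<rfloor>" for n :: nat
  have "filterlim (\<lambda>n. 2 powr ((D - \<eta>) * real n) / (2 * B)) at_top sequentially"
    using D\<eta> B by real_asymp
  then have lim_N: "filterlim N sequentially sequentially"
    unfolding N_def by (intro filterlim_compose[OF filterlim_nat_sequentially]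
        filterlim_compose[OF filterlim_floor_sequentially])
  have ev_dim: "eventually (\<lambda>N. ereal (if quantization_error N r \<nu> = 0 then 0
      else ln (real N) / (- ln (quantization_error N r \<nu>))) < ereal c) sequentially"
    using c(3) unfolding upper_quantization_dim_def by (rule Limsup_lessD)
  have "(\<lambda>N. quantization_error N r \<nu>) \<longlonglongrightarrow> 0"
    using lq_spectrum_less_at_quotient(1-3)[OF r, of "beta 0 + 1"] r
    by (intro quantization_error_tendsto_0) auto
  then have ev_small: "eventually (\<lambda>N. quantization_error N r \<nu> < 1) sequentially"
    by (rule order_tendstoD) simp
  have ev_pos: "eventually (\<lambda>n. N n > 0) sequentially"
    using lim_N eventually_gt_at_top[of 0] by (rule eventually_compose_filterlim[rotated])
  have ev_gap: "eventually (\<lambda>n. g * real n * ln 2 > ln (4 * B) + c * ln 2 / r) sequentially"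
    using g by real_asymp
  have "eventually (\<lambda>n. 2 powr ((D - \<eta>) * real n) \<le> real (card (heavy (D + \<eta>) n)) \<longrightarrow> False) sequentially"
    using eventually_compose_filterlim[OF ev_dim lim_N] eventually_compose_filterlim[OF ev_small lim_N]
      ev_pos ev_gap
  proof eventually_elim
    case (elim n)
    show ?case
    proof
      define X where "X = 2 powr ((D - \<eta>) * real n)"
      let ?e = "quantization_error (N n) r \<nu>" and ?h = "real (card (heavy (D + \<eta>) n))"
      assume "2 powr ((D - \<eta>) * real n) \<le> ?h"
      then have h: "X \<le> ?h" by (simp add: X_def)
      have X: "X > 0" by (simp add: X_def)
      have N_le: "real (N n) \<le> X / (2 * B)"
        unfolding N_def X_def using B by (intro of_nat_floor) auto
      have "X / (2 * B) < real (N n) + 1"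
        unfolding N_def X_def by linarith
      then have "X / (2 * B) < 2 * real (N n)" using elim by linarith
      then have N_ge: "X / (4 * B) \<le> real (N n)" by (simp add: field_simps)
      have "2 * B * real (N n) \<le> ?h"
        using N_le h B by (simp add: field_simps)
      then have "(?h / 2 * (1 / 2 ^ n) powr r * 2 powr (- ((D + \<eta>) * real n))) powr (1 / r) \<le> ?e"
        using r elim unfolding B_def by (intro quantization_error_ge) auto
      moreover have "(X / 2 * (1 / 2 ^ n) powr r * 2 powr (- ((D + \<eta>) * real n))) powr (1 / r)
          \<le> (?h / 2 * (1 / 2 ^ n) powr r * 2 powr (- ((D + \<eta>) * real n))) powr (1 / r)"
        using h r X by (intro powr_mono2 mult_right_mono) auto
      ultimately have e: "(X / 2 * (1 / 2 ^ n) powr r * 2 powr (- ((D + \<eta>) * real n))) powr (1 / r) \<le> ?e"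
        by linarith
      have lower_pos: "0 < (X / 2 * (1 / 2 ^ n) powr r * 2 powr (- ((D + \<eta>) * real n))) powr (1 / r)"
        using X by simp
      then have e_pos: "?e > 0" using e by linarith
      have "ln ((X / 2 * (1 / 2 ^ n) powr r * 2 powr (- ((D + \<eta>) * real n))) powr (1 / r)) \<le> ln ?e"
        using e lower_pos e_pos by (subst ln_le_cancel_iff)
      moreover have "ln ((X / 2 * (1 / 2 ^ n) powr r * 2 powr (- ((D + \<eta>) * real n))) powr (1 / r))
          = 1 / r * ((D - \<eta>) * real n * ln 2 - ln 2 - r * (real n * ln 2) - (D + \<eta>) * real n * ln 2)"
        unfolding X_def by (simp add: ln_powr ln_mult ln_div ln_realpow)
      \<comment> \<open>The count exponent \<open>D - \<eta>\<close> and the mass exponent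
        \<open>D + \<eta>\<close> cancel up to \<open>2 * \<eta>\<close>.\<close>
      moreover have "\<dots> = - (ln 2 / r + (1 + 2 * \<eta> / r) * (real n * ln 2))"
        using r by (simp add: field_simps)
      ultimately have ln_e: "- ln ?e \<le> ln 2 / r + (1 + 2 * \<eta> / r) * (real n * ln 2)"
        by linarith
      have neg: "- ln ?e > 0" using e_pos elim by simp
      have "ln (real (N n)) / (- ln ?e) < c" using elim e_pos by simp
      then have "ln (real (N n)) < c * (- ln ?e)" using neg by (simp add: field_simps)
      also have "\<dots> \<le> c * (ln 2 / r + (1 + 2 * \<eta> / r) * (real n * ln 2))"
        using ln_e c by (intro mult_left_mono) auto
      finally have 1: "ln (real (N n)) < c * (ln 2 / r + (1 + 2 * \<eta> / r) * (real n * ln 2))" .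
      have "ln (X / (4 * B)) \<le> ln (real (N n))"
        using N_ge X B elim by (subst ln_le_cancel_iff) auto
      moreover have "ln (X / (4 * B)) = (D - \<eta>) * (real n * ln 2) - ln (4 * B)"
        unfolding X_def using B by (subst ln_div) (auto simp: ln_powr)
      ultimately have "(D - \<eta>) * (real n * ln 2) - c * (1 + 2 * \<eta> / r) * (real n * ln 2)
          < ln (4 * B) + c * ln 2 / r"
        using 1 by (simp add: algebra_simps)
      moreover have "(D - \<eta>) * (real n * ln 2) - c * (1 + 2 * \<eta> / r) * (real n * ln 2) = g * (real n * ln 2)"
        unfolding left_diff_distrib[symmetric] gap g_def ..
      ultimately show False using elim by simp
    qed
  qed
  moreover have "frequently (\<lambda>n. 2 powr ((D - \<eta>) * real n) \<le> real (card (heavy (D + \<eta>) n))) sequentially"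
    unfolding D_def by (rule frequently_many_heavy[OF q beta \<eta>])
  ultimately show False by (simp add: frequently_def)
qed

subsection \<open>Packing and Hausdorff dimension\<close>

text \<open>Fixing the starting level \<open>m\<close> makes the count of cubes uniform over the
  set. Almost every point is recovered by a countable union over \<open>m\<close>, which packing
  measure tolerates.\<close>

definition regular :: "real \<Rightarrow> nat \<Rightarrow> (real ^ 'd) set" where
  "regular a m = (\<Inter>n\<in>{m..}. \<Union>k\<in>heavy a n. dyadic_cube n k)"

lemma finite_heavy [simp]: "finite (heavy a n)"
  by (simp add: heavy_def)

lemma mem_regular_iff: "x \<in> regular a m \<longleftrightarrow> (\<forall>n\<ge>m. dyadic_index n x \<in> heavy a n)"
  by (auto simp: regular_def mem_dyadic_cube_iff)

lemma borel_regular: "regular a m \<in> sets borel"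
  unfolding regular_def by (intro sets.countable_INT' sets.finite_UN) (auto simp: borel_dyadic_cube)

lemma card_heavy_le: "real (card (heavy a n)) \<le> 2 powr (a * real n)"
proof -
  have "real (card (heavy a n)) * 2 powr (- (a * real n)) = (\<Sum>k\<in>heavy a n. 2 powr (- (a * real n)))"
    by simp
  also have "\<dots> \<le> (\<Sum>k\<in>heavy a n. mass n k)"
    by (intro sum_mono) (simp add: heavy_def)
  also have "\<dots> \<le> (\<Sum>k\<in>charged n. mass n k)"
    by (intro sum_mono2) (auto simp: heavy_def)
  finally show ?thesis by (simp add: sum_mass_charged powr_minus field_simps)
qed

text \<open>On light cubes, splitting off \<open>mass powr (1 - q)\<close> bounds their total mass
  by \<open>zeta n q * 2 powr (- (a * n) * (1 - q))\<close>. The assumption on \<open>beta q\<close>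
  makes this summable.\<close>

lemma AE_eventually_heavy:
  assumes q: "0 < q" "q < 1" and beta: "beta q < a * (1 - q)"
  shows "AE x in \<nu>. \<exists>m. x \<in> regular a m"
proof -
  define bad where "bad n = space \<nu> - (\<Union>k\<in>heavy a n. dyadic_cube n k)" for n
  have bad_sets: "bad n \<in> sets \<nu>" for n
    unfolding bad_def by (intro sets.compl_sets sets.finite_UN) auto
  \<comment> \<open>Half of the gap: one half is spent on the bound for \<open>zeta\<close>, the
    other is the decay rate.\<close>
  define e where "e = (a * (1 - q) - beta q) / 2"
  have e: "e > 0" using beta by (simp add: e_def)
  have prob_bad: "prob (bad n) \<le> zeta n q * 2 powr (- (a * real n) * (1 - q))" for n
  proof -
    have "prob (bad n) = 1 - (\<Sum>k\<in>heavy a n. mass n k)"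
      unfolding bad_def by (subst prob_compl) (auto simp: measure_UN_dyadic_cube)
    also have "1 = (\<Sum>k\<in>charged n - heavy a n. mass n k) + (\<Sum>k\<in>heavy a n. mass n k)"
      unfolding sum_mass_charged[symmetric, of n] by (intro sum.subset_diff) (auto simp: heavy_def)
    finally have "prob (bad n) = (\<Sum>k\<in>charged n - heavy a n. mass n k)" by simp
    also have "\<dots> \<le> (\<Sum>k\<in>charged n - heavy a n. mass n k powr q * (2 powr (- (a * real n))) powr (1 - q))"
    proof (rule sum_mono)
      fix k assume k: "k \<in> charged n - heavy a n"
      then have "mass n k = mass n k powr q * mass n k powr (1 - q)"
        by (simp add: charged_def flip: powr_add)
      also have "\<dots> \<le> mass n k powr q * (2 powr (- (a * real n))) powr (1 - q)"
        using k q by (intro mult_left_mono powr_mono2) (auto simp: heavy_def)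
      finally show "mass n k \<le> mass n k powr q * (2 powr (- (a * real n))) powr (1 - q)" .
    qed
    also have "\<dots> \<le> (\<Sum>k\<in>charged n. mass n k powr q * (2 powr (- (a * real n))) powr (1 - q))"
      by (intro sum_mono2) auto
    also have "\<dots> = zeta n q * 2 powr (- (a * real n) * (1 - q))"
      by (simp add: zeta_def powr_powr flip: sum_distrib_right)
    finally show ?thesis .
  qed
  have "eventually (\<lambda>n. prob (bad n) \<le> (2 powr (- e)) ^ n) sequentially"
  proof (rule eventually_mono)
    show "\<forall>\<^sub>F n in sequentially. zeta n q \<le> 2 powr ((beta q + e) * real n)"
      using eventually_zeta_le_beta[of q e] q e by simp
    fix n assume "zeta n q \<le> 2 powr ((beta q + e) * real n)"
    then have "prob (bad n) \<le> 2 powr ((beta q + e) * real n) * 2 powr (- (a * real n) * (1 - q))"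
      using prob_bad[of n] by (meson mult_right_mono order_trans powr_ge_zero)
    also have "\<dots> = 2 powr (- e * real n)"
      unfolding powr_add[symmetric] by (rule arg_cong[where f = "\<lambda>x. 2 powr x"]) (simp add: e_def field_simps)
    also have "\<dots> = (2 powr (- e)) ^ n"
      by (simp add: powr_realpow[symmetric] powr_powr)
    finally show "prob (bad n) \<le> (2 powr (- e)) ^ n" .
  qed
  then have "eventually (\<lambda>n. norm (prob (bad n)) \<le> (2 powr (- e)) ^ n) sequentially"
    by simp
  moreover have "summable (\<lambda>n. (2 powr (- e)) ^ n)"
    using e by (intro summable_geometric) (simp add: powr_less_one)
  ultimately have "summable (\<lambda>n. prob (bad n))"
    by (rule summable_comparison_test_ev)
  then have "AE x in \<nu>. eventually (\<lambda>n. x \<in> space \<nu> - bad n) sequentially"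
    using bad_sets by (intro borel_cantelli_AE1) (auto simp: emeasure_eq_measure)
  then show ?thesis
  proof eventually_elim
    case (elim x)
    then obtain m where "\<And>n. n \<ge> m \<Longrightarrow> x \<in> space \<nu> - bad n"
      by (auto simp: eventually_sequentially)
    then have "x \<in> regular a m" by (auto simp: regular_def bad_def)
    then show ?case by blast
  qed
qed

lemma hausdorff_measure_regular:
  assumes "a < s" "0 < s"
  shows "hausdorff_measure s (regular a m) = 0"
proof -
  define K where "K = real CARD('d)"
  have K: "K > 0" by (simp add: K_def)
  have "hausdorff_premeasure s \<delta> (regular a m) = 0" if "\<delta> > 0" for \<delta>
  proof -
    have "eventually (\<lambda>n. K / 2 ^ n \<le> \<delta>) sequentially"
      using that K by real_asymp
    with eventually_ge_at_top[of m]
    have ev: "eventually (\<lambda>n. hausdorff_premeasure s \<delta> (regular a m)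
        \<le> ennreal (2 powr (a * real n) * (K / 2 ^ n) powr s)) sequentially"
    proof eventually_elim
      case (elim n)
      let ?c = "card (heavy a n)"
      obtain f where f: "bij_betw f {..<?c} (heavy a n)"
        using ex_bij_betw_nat_finite[OF finite_heavy, of a n] by (auto simp: atLeast0LessThan)
      \<comment> \<open>Covers are sequences, so the tail is padded with empty sets, which
        contribute \<open>0 powr s = 0\<close>.\<close>
      define U where "U i = (if i < ?c then closure (dyadic_cube n (f i)) else {})" for i
      have diam: "bounded (U i)" "diameter (U i) \<le> K / 2 ^ n" for i
        using diameter_closure_dyadic_cube[of n "f i"] K by (auto simp: U_def K_def)
      have "regular a m \<subseteq> (\<Union>k\<in>heavy a n. dyadic_cube n k)"
        using elim by (auto simp: regular_def)
      also have "\<dots> \<subseteq> (\<Union>i. U i)"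
      proof (rule UN_least)
        fix k assume "k \<in> heavy a n"
        then have "k \<in> f ` {..<?c}" using f by (simp add: bij_betw_def)
        then obtain i where "i < ?c" "f i = k" by blast
        then have "dyadic_cube n k \<subseteq> U i" by (simp add: U_def closure_subset)
        then show "dyadic_cube n k \<subseteq> (\<Union>i. U i)" by blast
      qed
      finally have "hausdorff_premeasure s \<delta> (regular a m) \<le> (\<Sum>i. ennreal (diameter (U i) powr s))"
        unfolding hausdorff_premeasure_def
        using diam elim by (intro INF_lower) (auto intro: order_trans)
      also have "\<dots> = (\<Sum>i<?c. ennreal (diameter (U i) powr s))"
        by (intro suminf_finite) (auto simp: U_def)
      also have "\<dots> \<le> (\<Sum>i<?c. ennreal ((K / 2 ^ n) powr s))"
        using diam assms diameter_ge_0 by (intro sum_mono ennreal_leI powr_mono2) auto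
      also have "\<dots> = ennreal (real ?c * (K / 2 ^ n) powr s)"
        by (simp add: ennreal_mult ennreal_of_nat_eq_real_of_nat)
      also have "\<dots> \<le> ennreal (2 powr (a * real n) * (K / 2 ^ n) powr s)"
        by (intro ennreal_leI mult_right_mono card_heavy_le) auto
      finally show ?case .
    qed
    define d where "d = s - a"
    have "d > 0" using assms by (simp add: d_def)
    then have "(\<lambda>n. 2 powr (- (d * real n))) \<longlonglongrightarrow> 0"
      by real_asymp
    then have "(\<lambda>n. K powr s * 2 powr (- ((s - a) * real n))) \<longlonglongrightarrow> 0"
      unfolding d_def by (rule tendsto_mult_right_zero)
    moreover have "2 powr (a * real n) * (K / 2 ^ n) powr s = K powr s * 2 powr (- ((s - a) * real n))" for n
    proof -
      have "(K / 2 ^ n) powr s = K powr s * 2 powr (- (real n * s))"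
        using K by (simp add: powr_divide powr_realpow[symmetric] powr_powr powr_minus_divide)
      then show ?thesis by (simp add: algebra_simps flip: powr_add)
    qed
    ultimately have "(\<lambda>n. ennreal (2 powr (a * real n) * (K / 2 ^ n) powr s)) \<longlonglongrightarrow> ennreal 0"
      by (intro tendsto_ennrealI) simp
    then have "hausdorff_premeasure s \<delta> (regular a m) \<le> ennreal 0"
      using ev by (intro tendsto_lowerbound) auto
    then show ?thesis by simp
  qed
  then have "hausdorff_measure s (regular a m) \<le> 0"
    unfolding hausdorff_measure_def by (intro SUP_least) simp
  then show ?thesis by simp
qed

text \<open>
  Disjoint balls of radius greater than the diameter bound of the cubes of level \<open>n + 1\<close> have their
  centres in different cubes of that level.
\<close>

lemma packing_premeasure_regular:
  assumes "a < s" "0 < s"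
  shows "packing_premeasure s (regular a m) = 0"
proof -
  define K where "K = real CARD('d)"
  have K: "K > 0" by (simp add: K_def)
  define \<theta> where "\<theta> = 2 powr (a - s)"
  have \<theta>: "0 < \<theta>" "\<theta> < 1" using assms by (auto simp: \<theta>_def powr_less_one)
  \<comment> \<open>The factor \<open>2 powr a\<close> arises because balls with radius about
    \<open>K / 2 ^ (n0 + j)\<close> have their centres counted one level finer.\<close>
  define c where "c = (2 * K) powr s * 2 powr a"
  have bound: "packing_premeasure s (regular a m) \<le> ennreal (c * \<theta> ^ n0 / (1 - \<theta>))"
    if n0: "n0 \<ge> m" for n0
  proof -
    have "(\<integral>\<^sup>+ p. ennreal ((2 * snd p) powr s) \<partial>count_space P) \<le> ennreal (c * \<theta> ^ n0 / (1 - \<theta>))"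
      if P: "P \<in> ball_packings (K / 2 ^ n0) (regular a m)" for P
    proof -
      \<comment> \<open>Balls sorted by dyadic size of the radius; the strict lower bound exceeds
        the diameter bound of cubes of level \<open>n0 + j + 1\<close>.\<close>
      define Q where "Q j = {p \<in> P. K / 2 ^ (n0 + j + 1) < snd p \<and> snd p \<le> K / 2 ^ (n0 + j)}" for j
      have P': "fst p \<in> regular a m" "0 < snd p" "snd p \<le> K / 2 ^ n0" if "p \<in> P" for p
        using that P by (auto simp: ball_packings_def)
      have disj: "cball (fst p) (snd p) \<inter> cball (fst p') (snd p') = {}" if "p \<in> P" "p' \<in> P" "p \<noteq> p'" for p p'
        using that P unfolding ball_packings_def disjoint_family_on_def
        by (auto simp: case_prod_beta)
      have cover: "\<exists>j. p \<in> Q j" if p: "p \<in> P" for p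
      proof -
        have "eventually (\<lambda>j. K / 2 ^ (n0 + j + 1) < snd p) sequentially"
          using K P'(2)[OF p] by real_asymp
        then have ex: "\<exists>j. K / 2 ^ (n0 + j + 1) < snd p"
          by (auto simp: eventually_sequentially)
        define j where "j = (LEAST j. K / 2 ^ (n0 + j + 1) < snd p)"
        have 1: "K / 2 ^ (n0 + j + 1) < snd p"
          unfolding j_def using ex by (rule LeastI_ex)
        have "snd p \<le> K / 2 ^ (n0 + j)"
        proof (cases j)
          case (Suc i)
          then have "\<not> K / 2 ^ (n0 + i + 1) < snd p"
            unfolding j_def by (intro not_less_Least) simp
          then show ?thesis using Suc by simp
        qed (use P'(3)[OF p] in simp)
        with 1 p show ?thesis by (auto simp: Q_def)
      qed
      have card_Q: "finite (Q j) \<and> real (card (Q j)) \<le> 2 powr (a * real (n0 + j + 1))" for j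
      proof -
        let ?n = "n0 + j + 1"
        have inj: "inj_on (\<lambda>p. dyadic_index ?n (fst p)) (Q j)"
        proof (rule inj_onI, rule ccontr)
          fix p p' assume p: "p \<in> Q j" "p' \<in> Q j" "p \<noteq> p'"
            and eq: "dyadic_index ?n (fst p) = dyadic_index ?n (fst p')"
          have "dist (fst p) (fst p') \<le> K / 2 ^ ?n"
            unfolding K_def by (rule dist_dyadic_index_le[OF eq])
          also have "\<dots> < snd p" using p by (simp add: Q_def)
          finally have "fst p' \<in> cball (fst p) (snd p) \<inter> cball (fst p') (snd p')"
            using P'(2)[of p'] p by (simp add: Q_def)
          then show False using disj[of p p'] p by (auto simp: Q_def)
        qed
        have sub: "(\<lambda>p. dyadic_index ?n (fst p)) ` Q j \<subseteq> heavy a ?n"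
          using P'(1) n0 by (auto simp: Q_def mem_regular_iff)
        have "finite (Q j)"
          using inj finite_subset[OF sub finite_heavy] by (rule finite_imageD[rotated])
        moreover have "card (Q j) \<le> card (heavy a ?n)"
          using inj sub finite_heavy by (rule card_inj_on_le)
        ultimately show ?thesis using card_heavy_le[of a ?n] by linarith
      qed
      define w where "w j = (2 * (K / 2 ^ (n0 + j))) powr s" for j
      have "(\<integral>\<^sup>+ p. ennreal ((2 * snd p) powr s) \<partial>count_space P)
          \<le> (\<integral>\<^sup>+ p. (\<Sum>j. ennreal (w j) * indicator (Q j) p) \<partial>count_space P)"
      proof (rule nn_integral_mono)
        fix p assume "p \<in> space (count_space P)"
        then have p: "p \<in> P" by simp
        then obtain j where j: "p \<in> Q j" using cover by blast
        then have "(2 * snd p) powr s \<le> w j"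
          unfolding w_def using P'(2)[OF p] assms by (intro powr_mono2) (auto simp: Q_def)
        then have "ennreal ((2 * snd p) powr s) \<le> ennreal (w j) * indicator (Q j) p"
          using j by (simp add: ennreal_leI)
        also have "\<dots> \<le> (\<Sum>j. ennreal (w j) * indicator (Q j) p)"
        proof -
          have "(\<Sum>j\<in>{j}. f j) \<le> (\<Sum>j. f j)" for f :: "nat \<Rightarrow> ennreal"
            by (intro sum_le_suminf) auto
          then show ?thesis by simp
        qed
        finally show "ennreal ((2 * snd p) powr s) \<le> (\<Sum>j. ennreal (w j) * indicator (Q j) p)" .
      qed
      also have "\<dots> = (\<Sum>j. \<integral>\<^sup>+ p. ennreal (w j) * indicator (Q j) p \<partial>count_space P)"
        by (rule nn_integral_suminf) simp
      also have "\<dots> = (\<Sum>j. ennreal (w j * real (card (Q j))))"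
      proof (rule suminf_cong)
        fix j
        have "Q j \<subseteq> P" by (auto simp: Q_def)
        then show "(\<integral>\<^sup>+ p. ennreal (w j) * indicator (Q j) p \<partial>count_space P) = ennreal (w j * real (card (Q j)))"
          using card_Q[of j]
          by (simp add: nn_integral_cmult_indicator w_def ennreal_mult ennreal_of_nat_eq_real_of_nat)
      qed
      also have "\<dots> \<le> (\<Sum>j. ennreal (c * \<theta> ^ n0 * \<theta> ^ j))"
      proof (intro suminf_le ennreal_leI)
        fix j
        have w_eq: "w j = (2 * K) powr s * 2 powr (- (real (n0 + j) * s))"
        proof -
          have "w j = (2 * K / 2 ^ (n0 + j)) powr s" by (simp add: w_def)
          also have "\<dots> = (2 * K) powr s / (2 powr real (n0 + j)) powr s"
          proof -
            have "(2 :: real) ^ (n0 + j) = 2 powr real (n0 + j)"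
              by (rule powr_realpow[symmetric]) simp
            then show ?thesis using K by (simp only: powr_divide)
          qed
          finally show ?thesis unfolding powr_powr by (simp add: powr_minus_divide)
        qed
        have "w j * real (card (Q j)) \<le> w j * 2 powr (a * real (n0 + j + 1))"
          using card_Q[of j] by (intro mult_left_mono) (auto simp: w_def)
        also have "w j * 2 powr (a * real (n0 + j + 1))
            = c * (2 powr (- (real (n0 + j) * s)) * 2 powr (a * real (n0 + j)))"
          unfolding w_eq by (simp add: c_def powr_add distrib_left)
        also have "2 powr (- (real (n0 + j) * s)) * 2 powr (a * real (n0 + j)) = \<theta> ^ (n0 + j)"
          unfolding \<theta>_def powr_add[symmetric]
          by (simp add: powr_realpow[symmetric] powr_powr algebra_simps)
        finally show "w j * real (card (Q j)) \<le> c * \<theta> ^ n0 * \<theta> ^ j"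
          by (simp add: power_add)
      qed auto
      also have "\<dots> = ennreal (\<Sum>j. c * \<theta> ^ n0 * \<theta> ^ j)"
        using \<theta> by (intro suminf_ennreal2 summable_mult summable_geometric) (auto simp: c_def)
      also have "(\<Sum>j. c * \<theta> ^ n0 * \<theta> ^ j) = c * \<theta> ^ n0 / (1 - \<theta>)"
        using \<theta> by (subst suminf_mult) (auto simp: suminf_geometric intro: summable_geometric)
      finally show ?thesis .
    qed
    then have "(SUP P\<in>ball_packings (K / 2 ^ n0) (regular a m).
        \<integral>\<^sup>+ p. ennreal ((2 * snd p) powr s) \<partial>count_space P) \<le> ennreal (c * \<theta> ^ n0 / (1 - \<theta>))"
      by (rule SUP_least)
    then show ?thesis
      unfolding packing_premeasure_def using K by (intro INF_lower2[of "K / 2 ^ n0"]) auto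
  qed
  have "(\<lambda>n0. c * \<theta> ^ n0 / (1 - \<theta>)) \<longlonglongrightarrow> c * 0 / (1 - \<theta>)"
    using \<theta> by (intro tendsto_intros LIMSEQ_realpow_zero) auto
  then have "(\<lambda>n0. ennreal (c * \<theta> ^ n0 / (1 - \<theta>))) \<longlonglongrightarrow> ennreal 0"
    by (intro tendsto_ennrealI) simp
  then have "packing_premeasure s (regular a m) \<le> ennreal 0"
    using eventually_mono[OF eventually_ge_at_top[of m] bound]
    by (intro tendsto_lowerbound) auto
  then show ?thesis by simp
qed

lemma packing_measure_UN_regular:
  assumes "a < s" "0 < s"
  shows "packing_measure s (\<Union>m. regular a m) = 0"
proof -
  have "packing_measure s (\<Union>m. regular a m) \<le> (\<Sum>m. packing_premeasure s (regular a m))"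
    unfolding packing_measure_def by (intro INF_lower) auto
  then show ?thesis by (simp add: packing_premeasure_regular[OF assms])
qed

text \<open>The packing dimension asks for a set of full measure, so the whole union over
  \<open>m\<close> is used. The Hausdorff dimension asks only for positive measure, so a single
  \<open>regular a m\<close> suffices.\<close>

lemma measure_dims_less_beta_0:
  assumes q: "0 < q" "q < 1" and beta: "beta q < beta 0 * (1 - q)"
  shows "upper_packing_dim_measure \<nu> < ereal (beta 0)" "lower_hausdorff_dim_measure \<nu> < ereal (beta 0)"
proof -
  have "beta q / (1 - q) < beta 0" using q beta by (simp add: field_simps)
  then obtain a where a: "beta q / (1 - q) < a" "a < beta 0" using dense by blast
  have beta_a: "beta q < a * (1 - q)" using q a(1) by (simp add: field_simps)
  have "0 \<le> beta q / (1 - q)" using beta_nonneg[of q] q by simp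
  then have a0: "a > 0" using a by linarith
  note AE = AE_eventually_heavy[OF q beta_a]
  define A where "A = (\<Union>m. regular a m)"
  have A: "A \<in> sets borel" unfolding A_def using borel_regular by auto
  have "prob A = 1"
    using AE A by (subst prob_eq_1) (auto simp: sets_eq_borel A_def)
  then have full: "emeasure \<nu> A = emeasure \<nu> UNIV"
    using prob_space by (simp add: emeasure_eq_measure)
  have "packing_dim A \<le> ereal a"
  proof (rule ereal_le_epsilon2)
    fix e :: real assume "e > 0"
    then show "packing_dim A \<le> ereal a + ereal e"
      unfolding packing_dim_def A_def
      using packing_measure_UN_regular[of a "a + e"] a0 by (intro INF_lower2[of "a + e"]) auto
  qed
  moreover have "upper_packing_dim_measure \<nu> \<le> packing_dim A"
    unfolding upper_packing_dim_measure_def using A full by (intro INF_lower) auto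
  ultimately show "upper_packing_dim_measure \<nu> < ereal (beta 0)"
    using a(2) by (meson less_ereal.simps(1) order.trans order.strict_trans1)
  have "\<exists>m. emeasure \<nu> (regular a m) > 0"
  proof (rule ccontr)
    assume "\<not> ?thesis"
    then have "regular a m \<in> null_sets \<nu>" for m
      by (auto simp: null_sets_def sets_eq_borel borel_regular)
    then have "A \<in> null_sets \<nu>" unfolding A_def by (rule null_sets_UN)
    then show False using \<open>prob A = 1\<close> by (simp add: null_sets_def emeasure_eq_measure)
  qed
  then obtain m where m: "emeasure \<nu> (regular a m) > 0" by blast
  have "hausdorff_dim (regular a m) \<le> ereal a"
  proof (rule ereal_le_epsilon2)
    fix e :: real assume "e > 0"
    then show "hausdorff_dim (regular a m) \<le> ereal a + ereal e"
      unfolding hausdorff_dim_def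
      using hausdorff_measure_regular[of a "a + e" m] a0 by (intro INF_lower2[of "a + e"]) auto
  qed
  moreover have "lower_hausdorff_dim_measure \<nu> \<le> hausdorff_dim (regular a m)"
    unfolding lower_hausdorff_dim_measure_def using m borel_regular by (intro INF_lower) auto
  ultimately show "lower_hausdorff_dim_measure \<nu> < ereal (beta 0)"
    using a(2) by (meson less_ereal.simps(1) order.trans order.strict_trans1)
qed

end

subsection \<open>The equivalences\<close>

theorem corollary1p9:
  fixes \<nu> :: "(real ^ 'd) measure"
  assumes "prob_space \<nu>"
    and "sets \<nu> = sets borel"
    and "compact (measure_support \<nu>)"
    and "upper_minkowski_dim \<nu> > 0"
  shows "let
      S1 = (\<exists>r>0. upper_quantization_dim r \<nu> = upper_minkowski_dim \<nu>);
      S2 = (\<exists>q. 0 < q \<and> q < 1 \<and> upper_renyi_dim \<nu> q = upper_minkowski_dim \<nu>);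
      S3 = (\<exists>D. ((\<lambda>q. real_of_ereal (lq_spectrum \<nu> q)) has_real_derivative D) (at_left 1)
                \<and> ereal D \<le> - upper_minkowski_dim \<nu>);
      S4 = (\<forall>q\<in>{0..1}. lq_spectrum \<nu> q = upper_minkowski_dim \<nu> * ereal (1 - q));
      S5 = (\<forall>r>0. upper_quantization_dim r \<nu> = upper_minkowski_dim \<nu>)
    in (S1 \<longleftrightarrow> S2) \<and> (S2 \<longleftrightarrow> S3) \<and> (S3 \<longleftrightarrow> S4) \<and> (S4 \<longleftrightarrow> S5)
       \<and> (upper_packing_dim_measure \<nu> = upper_minkowski_dim \<nu> \<longrightarrow> S1 \<and> S2 \<and> S3 \<and> S4 \<and> S5)
       \<and> (lower_hausdorff_dim_measure \<nu> = upper_minkowski_dim \<nu> \<longrightarrow> S1 \<and> S2 \<and> S3 \<and> S4 \<and> S5)"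
proof -
  interpret compact_support_prob \<nu>
    using assms by (simp add: compact_support_prob_def compact_support_prob_axioms_def)
  define D where "D = beta 0"
  have dim: "upper_minkowski_dim \<nu> = ereal D"
    by (simp add: upper_minkowski_dim_eq_beta D_def)
  have D: "D > 0" using assms(4) by (simp add: dim)
  define S1 where "S1 \<longleftrightarrow> (\<exists>r>0. upper_quantization_dim r \<nu> = upper_minkowski_dim \<nu>)"
  define S2 where "S2 \<longleftrightarrow> (\<exists>q. 0 < q \<and> q < 1 \<and> upper_renyi_dim \<nu> q = upper_minkowski_dim \<nu>)"
  define S3 where "S3 \<longleftrightarrow> (\<exists>D. ((\<lambda>q. real_of_ereal (lq_spectrum \<nu> q)) has_real_derivative D) (at_left 1)
                \<and> ereal D \<le> - upper_minkowski_dim \<nu>)"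
  define S4 where "S4 \<longleftrightarrow> (\<forall>q\<in>{0..1}. lq_spectrum \<nu> q = upper_minkowski_dim \<nu> * ereal (1 - q))"
  define S5 where "S5 \<longleftrightarrow> (\<forall>r>0. upper_quantization_dim r \<nu> = upper_minkowski_dim \<nu>)"
  have S4_iff: "S4 \<longleftrightarrow> (\<forall>q\<in>{0..1}. beta q = D * (1 - q))"
    unfolding S4_def dim by (auto simp: lq_spectrum_eq_beta)
  have linear_or_below: "S4 \<or> (\<forall>q. 0 < q \<and> q < 1 \<longrightarrow> beta q < D * (1 - q))"
  proof (cases S4)
    case False
    then obtain p where p: "0 \<le> p" "p \<le> 1" "beta p \<noteq> D * (1 - p)"
      by (auto simp: S4_iff)
    then have "p \<noteq> 0" "p \<noteq> 1" "beta p \<le> D * (1 - p)"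
      using beta_le_linear[of p] by (auto simp: D_def)
    then have "0 < p" "p < 1" "beta p < beta 0 * (1 - p)" using p by (auto simp: D_def)
    then show ?thesis
      using beta_strictly_below_chord by (auto simp: D_def)
  qed simp
  have S4I: S4 if "0 < q" "q < 1" "D * (1 - q) \<le> beta q" for q
    using linear_or_below that by force
  \<comment> \<open>Strictness holds at every interior point once linearity fails, so one fixed
    point serves all contrapositions.\<close>
  have half: "beta (1 / 2) < beta 0 * (1 - 1 / 2)" if "\<not> S4"
  proof -
    have "beta (1 / 2) < D * (1 - 1 / 2)"
      using linear_or_below that by (elim disjE allE[of _ "1 / 2"]) simp_all
    then show ?thesis by (simp only: D_def)
  qed
  have "S5" if S4
    unfolding S5_def dim
  proof (intro allI impI antisym)
    fix r :: real assume r: "r > 0"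
    have "beta (1 / 2) = D * (1 - 1 / 2)" using that by (simp add: S4_iff)
    then show "ereal D \<le> upper_quantization_dim r \<nu>"
      using upper_quantization_dim_ge_beta_0[OF r, of "1 / 2"] D by (simp add: D_def)
    show "upper_quantization_dim r \<nu> \<le> ereal D"
      unfolding D_def by (rule upper_quantization_dim_le_beta_0[OF r])
  qed
  moreover have S1 if S5
    using that zero_less_one unfolding S1_def S5_def by blast
  moreover have S4 if S1
  proof (rule ccontr)
    assume "\<not> S4"
    then have "upper_quantization_dim r \<nu> < ereal D" if "r > 0" for r
      using upper_quantization_dim_less_beta_0[OF that _ _ half] by (simp add: D_def)
    then show False using \<open>S1\<close> unfolding S1_def dim by force
  qed
  moreover have S2 if S4
    unfolding S2_def dim
  proof (intro exI[of _ "1 / 2"] conjI)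
    have "beta (1 / 2) = D * (1 - 1 / 2)" using that by (simp add: S4_iff)
    then show "upper_renyi_dim \<nu> (1 / 2) = ereal D"
      by (simp add: upper_renyi_dim_def lq_spectrum_eq_beta)
  qed auto
  moreover have S4 if S2: S2
  proof -
    obtain q where q: "0 < q" "q < 1" "upper_renyi_dim \<nu> q = ereal D"
      using S2 by (auto simp: S2_def dim)
    then have "beta q / (1 - q) = D"
      by (simp add: upper_renyi_dim_def lq_spectrum_eq_beta)
    then have "D * (1 - q) \<le> beta q" using q by (simp add: field_simps)
    then show S4 by (rule S4I[OF q(1,2)])
  qed
  moreover have S3 if S4
    unfolding S3_def dim beta_def[symmetric]
  proof (intro exI[of _ "- D"] conjI)
    have "((\<lambda>q. D * (1 - q)) has_real_derivative - D) (at_left 1)"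
      by (auto intro!: derivative_eq_intros)
    \<comment> \<open>The derivative at 1 also involves the value there, where both functions
      vanish.\<close>
    moreover have "eventually (\<lambda>q. D * (1 - q) = beta q) (at_left 1)"
      using \<open>S4\<close> by (intro eventually_at_leftI[of 0]) (auto simp: S4_iff)
    ultimately show "(beta has_real_derivative - D) (at_left 1)"
      using has_field_derivative_cong_eventually[of "\<lambda>q. D * (1 - q)" beta 1 "{..<1}"] by simp
  qed simp
  moreover have S4 if S3: S3
  proof -
    obtain D' where D': "(beta has_real_derivative D') (at_left 1)" "D' \<le> - D"
      using S3 by (auto simp: S3_def dim beta_def[abs_def])
    have "- beta (1 / 2) / (1 - 1 / 2) \<le> D'"
      by (rule left_derivative_ge[OF D'(1)]) auto
    then have "D * (1 - 1 / 2) \<le> beta (1 / 2)" using D'(2) by simp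
    then show S4 by (rule S4I[rotated 2]) auto
  qed
  moreover have S4 if "upper_packing_dim_measure \<nu> = upper_minkowski_dim \<nu>"
    using measure_dims_less_beta_0(1)[OF _ _ half] that by (force simp: dim D_def)
  moreover have S4 if "lower_hausdorff_dim_measure \<nu> = upper_minkowski_dim \<nu>"
    using measure_dims_less_beta_0(2)[OF _ _ half] that by (force simp: dim D_def)
  ultimately show ?thesis
    unfolding Let_def S1_def[symmetric] S2_def[symmetric] S3_def[symmetric] S4_def[symmetric] S5_def[symmetric]
    by blast
qed

end
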